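(* Let $C_{w,f}$ be a weighted composition operator on $L^1(\mu)$ (the case $p=1$), and let $\mathfrak{X}$ be the closed subspace of $L^1(\mu)$ generated by (i.e. the closed linear span of) the characteristic functions $\chi_B$ such that $B$ is a measurable set of finite $\mu$-measure satisfying \[ \liminf_{N \to \infty} \frac{1}{N} \sum_{n=1}^N \mu_n(f^{-n}(B)) = 0. \] Then the following assertions are equivalent: (i) $C_{w,f}$ is mean Li-Yorke chaotic; (ii) there exists a nonempty countable family $(B_i)_{i \in I}$ of measurable sets of finite positive $\mu$-measure such that \[ \liminf_{N \to \infty} \frac{1}{N} \sum_{n=1}^N \mu_n(f^{-n}(B_i)) = 0 \quad \text{for all } i \in I \] and \[ \sup \Big\{\frac{1}{N} \sum_{n=1}^N \frac{\mu_n(f^{-n}(B_i))}{\mu(B_i)} : i \in I,\ N \in \mathbb{N} \Big\} = \infty; \] (iii) $C_{w,f}$ is not absolutely Cesàro bounded in $\mathfrak{X}$.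
   Context: Fix $\mathbb{K} = \mathbb{R}$ or $\mathbb{C}$ and an arbitrary positive measure space $(X,\mathfrak{M},\mu)$. $L^1(\mu)$ is the Banach space over $\mathbb{K}$ of all $\mathbb{K}$-valued integrable functions with norm $\|\varphi\|_1 = \int_X |\varphi| d\mu$. A weighted composition operator on $L^1(\mu)$ is the map $C_{w,f}(\varphi) = (\varphi \circ f)\cdot w$, where $w : X \to \mathbb{K}$ is measurable with $\varphi\cdot w \in L^1(\mu)$ for all $\varphi \in L^1(\mu)$, $f : X \to X$ is bimeasurable (i.e. $f(B) \in \mathfrak{M}$ and $f^{-1}(B) \in \mathfrak{M}$ whenever $B \in \mathfrak{M}$), and there is a constant $c \in (0,\infty)$ such that $\int_B |w| d\mu \le c\,\mu(f(B))$ for every $B \in \mathfrak{M}$; these conditions make $C_{w,f}$ a well-defined bounded linear operator on $L^1(\mu)$. Put $w^{(1)} = w$, $w^{(n)} = (w\circ f^{n-1})\cdots(w\circ f)\cdot w$ for $n \ge 2$, and $\mu_n(B) = \int_B |w^{(n)}| d\mu$ for $B \in \mathfrak{M}$, $n \in \mathbb{N} = \{1,2,\ldots\}$. An operator $T$ on a Banach space $Y$ is absolutely Cesàro bounded in a subspace $Z$ of $Y$ if there exists $C \in (0,\infty)$ such that $\sup_{N\in\mathbb{N}} \frac{1}{N}\sum_{n=1}^N \|T^n y\| \le C\|y\|$ for all $y \in Z$. A map $g : M \to M$ on a metric space $(M,d)$ is mean Li-Yorke chaotic if there is an uncountable set $S \subset M$ such that for each pair $(x,y)$ of distinct points of $S$: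 $\liminf_{N\to\infty} \frac{1}{N}\sum_{n=1}^N d(g^n(x),g^n(y)) = 0$ and $\limsup_{N\to\infty} \frac{1}{N}\sum_{n=1}^N d(g^n(x),g^n(y)) > 0$. *)

theory Defs
  imports "HOL-Analysis.Analysis"
begin

section \<open>The space of classes of integrable functions\<close>

text \<open>
  The scalar field is a type \<open>'k :: {real_normed_field, euclidean_space}\<close>. The instances of this sort
  are finite-dimensional fields over the reals with a multiplicative norm, so up to isometric
  isomorphism they are exactly \<open>real\<close> and \<open>complex\<close>.
  Elements of the space are classes of integrable functions modulo equality almost everywhere.
\<close>

definition ae_eq_rel :: "'a measure \<Rightarrow> (('a \<Rightarrow> 'k::{real_normed_field, euclidean_space}) \<times> ('a \<Rightarrow> 'k)) set" where
  "ae_eq_rel M = {(\<phi>, \<psi>). integrable M \<phi> \<and> integrable M \<psi> \<and> (AE x in M. \<phi> x = \<psi> x)}"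

definition L1 :: "'a measure \<Rightarrow> ('a \<Rightarrow> 'k::{real_normed_field, euclidean_space}) set set" where
  "L1 M = {\<phi>. integrable M \<phi>} // ae_eq_rel M"

definition L1_class :: "'a measure \<Rightarrow> ('a \<Rightarrow> 'k::{real_normed_field, euclidean_space}) \<Rightarrow> ('a \<Rightarrow> 'k) set" where
  "L1_class M \<phi> = ae_eq_rel M `` {\<phi>}"

definition L1_rep :: "('a \<Rightarrow> 'k::{real_normed_field, euclidean_space}) set \<Rightarrow> 'a \<Rightarrow> 'k" where
  "L1_rep u = (SOME \<phi>. \<phi> \<in> u)"

definition L1_norm :: "'a measure \<Rightarrow> ('a \<Rightarrow> 'k::{real_normed_field, euclidean_space}) set \<Rightarrow> real" where
  "L1_norm M u = (\<integral>x. norm (L1_rep u x) \<partial>M)"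

definition L1_dist :: "'a measure \<Rightarrow> ('a \<Rightarrow> 'k::{real_normed_field, euclidean_space}) set \<Rightarrow> ('a \<Rightarrow> 'k) set \<Rightarrow> real" where
  "L1_dist M u v = (\<integral>x. norm (L1_rep u x - L1_rep v x) \<partial>M)"

definition L1_span :: "'a measure \<Rightarrow> ('a \<Rightarrow> 'k::{real_normed_field, euclidean_space}) set \<Rightarrow> ('a \<Rightarrow> 'k) set set" where
  "L1_span M A = {L1_class M (\<lambda>x. \<Sum>\<phi>\<in>F. c \<phi> * \<phi> x) |F c. finite F \<and> F \<subseteq> A}"

definition L1_closed_span :: "'a measure \<Rightarrow> ('a \<Rightarrow> 'k::{real_normed_field, euclidean_space}) set \<Rightarrow> ('a \<Rightarrow> 'k) set set" where
  "L1_closed_span M A = Metric_space.mtopology (L1 M) (L1_dist M) closure_of L1_span M A"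

lemma L1_class_in [simp]: "integrable M \<phi> \<Longrightarrow> L1_class M \<phi> \<in> L1 M"
  by (auto simp: L1_class_def L1_def intro: quotientI)

lemma L1_rep:
  assumes "u \<in> L1 M"
  shows "integrable M (L1_rep u)" and "L1_class M (L1_rep u) = u"
proof -
  obtain \<phi> where \<phi>: "integrable M \<phi>" "u = ae_eq_rel M `` {\<phi>}"
    using assms by (auto simp: L1_def elim: quotientE)
  then have "\<phi> \<in> u" by (auto simp: ae_eq_rel_def)
  then have "L1_rep u \<in> u" unfolding L1_rep_def by (rule someI[of "\<lambda>\<phi>. \<phi> \<in> u"])
  then have r: "integrable M (L1_rep u)" "AE x in M. \<phi> x = L1_rep u x"
    using \<phi> by (auto simp: ae_eq_rel_def)
  show "integrable M (L1_rep u)" by fact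
  have "(AE x in M. L1_rep u x = \<psi> x) \<longleftrightarrow> (AE x in M. \<phi> x = \<psi> x)" for \<psi>
  proof
    show "AE x in M. \<phi> x = \<psi> x" if "AE x in M. L1_rep u x = \<psi> x"
      using r(2) that by eventually_elim simp
    show "AE x in M. L1_rep u x = \<psi> x" if "AE x in M. \<phi> x = \<psi> x"
      using r(2) that by eventually_elim simp
  qed
  then show "L1_class M (L1_rep u) = u"
    using r(1) \<phi> by (auto simp: L1_class_def ae_eq_rel_def)
qed

lemma L1_class_eq_iff:
  assumes "integrable M \<phi>" "integrable M \<psi>"
  shows "L1_class M \<phi> = L1_class M \<psi> \<longleftrightarrow> (AE x in M. \<phi> x = \<psi> x)"
proof
  assume "L1_class M \<phi> = L1_class M \<psi>"
  moreover have "\<psi> \<in> L1_class M \<psi>" using assms by (auto simp: L1_class_def ae_eq_rel_def)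
  ultimately have "\<psi> \<in> L1_class M \<phi>" by simp
  then show "AE x in M. \<phi> x = \<psi> x" by (auto simp: L1_class_def ae_eq_rel_def)
next
  assume a: "AE x in M. \<phi> x = \<psi> x"
  have "(AE x in M. \<phi> x = \<theta> x) \<longleftrightarrow> (AE x in M. \<psi> x = \<theta> x)" for \<theta>
  proof
    show "AE x in M. \<psi> x = \<theta> x" if "AE x in M. \<phi> x = \<theta> x"
      using a that by eventually_elim simp
    show "AE x in M. \<phi> x = \<theta> x" if "AE x in M. \<psi> x = \<theta> x"
      using a that by eventually_elim simp
  qed
  then show "L1_class M \<phi> = L1_class M \<psi>"
    using assms by (auto simp: L1_class_def ae_eq_rel_def)
qed

lemma L1_rep_class:
  assumes "integrable M \<phi>"
  shows "AE x in M. L1_rep (L1_class M \<phi>) x = \<phi> x"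
  using L1_rep[OF L1_class_in[OF assms]] L1_class_eq_iff[OF _ assms] by blast

lemma L1_norm_class:
  assumes "integrable M \<phi>"
  shows "L1_norm M (L1_class M \<phi>) = (\<integral>x. norm (\<phi> x) \<partial>M)"
proof -
  note [measurable] = borel_measurable_integrable[OF assms]
    borel_measurable_integrable[OF L1_rep(1)[OF L1_class_in[OF assms]]]
  have "AE x in M. norm (L1_rep (L1_class M \<phi>) x) = norm (\<phi> x)"
    using L1_rep_class[OF assms] by eventually_elim simp
  then show ?thesis
    unfolding L1_norm_def by (intro integral_cong_AE) measurable
qed

lemma L1_dist_class:
  assumes "integrable M \<phi>" "integrable M \<psi>"
  shows "L1_dist M (L1_class M \<phi>) (L1_class M \<psi>) = (\<integral>x. norm (\<phi> x - \<psi> x) \<partial>M)"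
proof -
  note [measurable] = assms[THEN borel_measurable_integrable]
    assms[THEN L1_class_in, THEN L1_rep(1), THEN borel_measurable_integrable]
  have "AE x in M. norm (L1_rep (L1_class M \<phi>) x - L1_rep (L1_class M \<psi>) x) = norm (\<phi> x - \<psi> x)"
    using L1_rep_class[OF assms(1)] L1_rep_class[OF assms(2)] by eventually_elim simp
  then show ?thesis
    unfolding L1_dist_def by (intro integral_cong_AE) measurable
qed

lemma Metric_space_L1: "Metric_space (L1 M) (L1_dist M)"
proof
  fix u v :: "('a \<Rightarrow> 'k::{real_normed_field, euclidean_space}) set"
  show "0 \<le> L1_dist M u v" by (simp add: L1_dist_def)
  show "L1_dist M u v = L1_dist M v u" by (simp add: L1_dist_def norm_minus_commute)
next
  fix u v :: "('a \<Rightarrow> 'k::{real_normed_field, euclidean_space}) set"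
  assume u: "u \<in> L1 M" and v: "v \<in> L1 M"
  have "L1_dist M u v = 0 \<longleftrightarrow> (AE x in M. L1_rep u x = L1_rep v x)"
    unfolding L1_dist_def using L1_rep(1)[OF u] L1_rep(1)[OF v]
    by (subst integral_nonneg_eq_0_iff_AE) auto
  also have "\<dots> \<longleftrightarrow> u = v"
    using L1_class_eq_iff[OF L1_rep(1)[OF u] L1_rep(1)[OF v]] L1_rep(2)[OF u] L1_rep(2)[OF v] by simp
  finally show "L1_dist M u v = 0 \<longleftrightarrow> u = v" .
next
  fix u v t :: "('a \<Rightarrow> 'k::{real_normed_field, euclidean_space}) set"
  assume *: "u \<in> L1 M" "v \<in> L1 M" "t \<in> L1 M"
  note [simp] = *[THEN L1_rep(1)]
  have "L1_dist M u t \<le> (\<integral>x. norm (L1_rep u x - L1_rep v x) + norm (L1_rep v x - L1_rep t x) \<partial>M)"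
    unfolding L1_dist_def by (intro integral_mono) (auto intro: norm_diff_triangle_ineq order_trans[OF _ norm_triangle_ineq])
  also have "\<dots> = L1_dist M u v + L1_dist M v t"
    unfolding L1_dist_def by (intro Bochner_Integration.integral_add) auto
  finally show "L1_dist M u t \<le> L1_dist M u v + L1_dist M v t" .
qed

section \<open>Weighted composition operators\<close>

text \<open>
  \<open>\<mu>(f(B))\<close> may be infinite, so the integral estimate is stated in the extended nonnegative reals.
\<close>

locale weighted_composition =
  fixes M :: "'a measure" and w :: "'a \<Rightarrow> 'k::{real_normed_field, euclidean_space}" and f :: "'a \<Rightarrow> 'a"
  assumes w_measurable: "w \<in> borel_measurable M"
    and w_mult: "\<And>\<phi> :: 'a \<Rightarrow> 'k. integrable M \<phi> \<Longrightarrow> integrable M (\<lambda>x. \<phi> x * w x)"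
    and f_measurable: "f \<in> measurable M M"
    and f_image: "\<And>B. B \<in> sets M \<Longrightarrow> f ` B \<in> sets M"
    and w_bound: "\<exists>c::real. 0 < c \<and>
      (\<forall>B\<in>sets M. (\<integral>\<^sup>+x\<in>B. ennreal (norm (w x)) \<partial>M) \<le> ennreal c * emeasure M (f ` B))"

definition wco :: "'a measure \<Rightarrow> ('a \<Rightarrow> 'k::{real_normed_field, euclidean_space}) \<Rightarrow> ('a \<Rightarrow> 'a)
    \<Rightarrow> ('a \<Rightarrow> 'k) set \<Rightarrow> ('a \<Rightarrow> 'k) set" where
  "wco M w f u = L1_class M (\<lambda>x. L1_rep u (f x) * w x)"

text \<open>The next lemmas show that \<open>wco\<close> does not depend on the choice of representatives.\<close>

context weighted_composition
begin

lemma nn_integral_comp_bound: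
  "\<exists>c::real. 0 < c \<and> (\<forall>g\<in>borel_measurable M.
     (\<integral>\<^sup>+x. g (f x) * ennreal (norm (w x)) \<partial>M) \<le> ennreal c * (\<integral>\<^sup>+x. g x \<partial>M))"
proof -
  note [measurable] = w_measurable f_measurable
  obtain c :: real where c: "0 < c"
    "\<And>B. B \<in> sets M \<Longrightarrow> (\<integral>\<^sup>+x\<in>B. ennreal (norm (w x)) \<partial>M) \<le> ennreal c * emeasure M (f ` B)"
    using w_bound by blast
  let ?D = "density M (\<lambda>x. ennreal (norm (w x)))"
  let ?N = "distr ?D M f"
  have "emeasure ?N B \<le> emeasure (scale_measure (ennreal c) M) B" for B
  proof (cases "B \<in> sets M")
    case B [measurable]: True
    have P: "f -` B \<inter> space M \<in> sets M" by measurable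
    have "emeasure ?N B = (\<integral>\<^sup>+x\<in>f -` B \<inter> space M. ennreal (norm (w x)) \<partial>M)"
      using P by (simp add: emeasure_distr emeasure_density)
    also have "\<dots> \<le> ennreal c * emeasure M (f ` (f -` B \<inter> space M))"
      by (rule c(2)) (rule P)
    also have "\<dots> \<le> ennreal c * emeasure M B"
      using B by (intro mult_left_mono emeasure_mono) auto
    finally show ?thesis by simp
  qed (simp add: emeasure_notin_sets)
  then have le: "?N \<le> scale_measure (ennreal c) M"
    by (simp add: le_measure_iff le_fun_def space_scale_measure)
  have "(\<integral>\<^sup>+x. g (f x) * ennreal (norm (w x)) \<partial>M) \<le> ennreal c * (\<integral>\<^sup>+x. g x \<partial>M)"
    if [measurable]: "g \<in> borel_measurable M" for g :: "'a \<Rightarrow> ennreal"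
  proof -
    have "(\<integral>\<^sup>+x. g (f x) * ennreal (norm (w x)) \<partial>M) = nn_integral ?N g"
      by (simp add: nn_integral_distr nn_integral_density mult.commute)
    also have "\<dots> \<le> nn_integral (scale_measure (ennreal c) M) g"
      by (rule nn_integral_mono_measure[OF _ le]) simp
    also have "\<dots> = ennreal c * (\<integral>\<^sup>+x. g x \<partial>M)"
      by (rule nn_integral_scale_measure) measurable
    finally show ?thesis .
  qed
  with c(1) show ?thesis by blast
qed

lemma integrable_comp:
  assumes "integrable M \<phi>"
  shows "integrable M (\<lambda>x. \<phi> (f x) * w x)"
proof -
  note [measurable] = w_measurable f_measurable borel_measurable_integrable[OF assms]
  obtain c :: real where "(\<integral>\<^sup>+x. ennreal (norm (\<phi> (f x))) * ennreal (norm (w x)) \<partial>M)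
      \<le> ennreal c * (\<integral>\<^sup>+x. ennreal (norm (\<phi> x)) \<partial>M)"
    using nn_integral_comp_bound by force
  also have "\<dots> < \<infinity>"
    using assms by (auto simp: integrable_iff_bounded ennreal_mult_less_top)
  finally show ?thesis
    by (intro integrableI_bounded) (simp_all add: norm_mult ennreal_mult)
qed

lemma AE_comp:
  assumes "integrable M \<phi>" "integrable M \<psi>" "AE x in M. \<phi> x = \<psi> x"
  shows "AE x in M. \<phi> (f x) * w x = \<psi> (f x) * w x"
proof -
  note [measurable] = w_measurable f_measurable
    borel_measurable_integrable[OF assms(1)] borel_measurable_integrable[OF assms(2)]
  obtain c :: real where "(\<integral>\<^sup>+x. ennreal (norm (\<phi> (f x) - \<psi> (f x))) * ennreal (norm (w x)) \<partial>M)
      \<le> ennreal c * (\<integral>\<^sup>+x. ennreal (norm (\<phi> x - \<psi> x)) \<partial>M)"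
    using nn_integral_comp_bound by force
  also have "(\<integral>\<^sup>+x. ennreal (norm (\<phi> x - \<psi> x)) \<partial>M) = 0"
    using assms(3) by (subst nn_integral_0_iff_AE) (auto elim: eventually_mono)
  finally have "AE x in M. ennreal (norm (\<phi> (f x) - \<psi> (f x))) * ennreal (norm (w x)) = 0"
    by (subst (asm) mult_zero_right, subst (asm) le_zero_eq, subst (asm) nn_integral_0_iff_AE) auto
  then show ?thesis
    by eventually_elim auto
qed

lemma wco_in_L1: "u \<in> L1 M \<Longrightarrow> wco M w f u \<in> L1 M"
  unfolding wco_def by (intro L1_class_in integrable_comp L1_rep)

lemma wco_class:
  assumes "integrable M \<phi>"
  shows "wco M w f (L1_class M \<phi>) = L1_class M (\<lambda>x. \<phi> (f x) * w x)"
proof -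
  have r: "integrable M (L1_rep (L1_class M \<phi>))"
    using assms by (intro L1_rep L1_class_in)
  show ?thesis
    unfolding wco_def L1_class_eq_iff[OF integrable_comp[OF r] integrable_comp[OF assms]]
    by (rule AE_comp[OF r assms L1_rep_class[OF assms]])
qed

end

definition iter_weight :: "('a \<Rightarrow> 'k::{real_normed_field, euclidean_space}) \<Rightarrow> ('a \<Rightarrow> 'a) \<Rightarrow> nat \<Rightarrow> 'a \<Rightarrow> 'k" where
  "iter_weight w f n x = (\<Prod>i<n. w ((f ^^ i) x))"

definition iter_measure :: "'a measure \<Rightarrow> ('a \<Rightarrow> 'k::{real_normed_field, euclidean_space}) \<Rightarrow> ('a \<Rightarrow> 'a)
    \<Rightarrow> nat \<Rightarrow> 'a set \<Rightarrow> ennreal" where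
  "iter_measure M w f n B = (\<integral>\<^sup>+x\<in>B. ennreal (norm (iter_weight w f n x)) \<partial>M)"

definition iter_preimage :: "'a measure \<Rightarrow> ('a \<Rightarrow> 'a) \<Rightarrow> nat \<Rightarrow> 'a set \<Rightarrow> 'a set" where
  "iter_preimage M f n B = (f ^^ n) -` B \<inter> space M"

definition liminf_mean_zero :: "'a measure \<Rightarrow> ('a \<Rightarrow> 'k::{real_normed_field, euclidean_space}) \<Rightarrow> ('a \<Rightarrow> 'a)
    \<Rightarrow> 'a set \<Rightarrow> bool" where
  "liminf_mean_zero M w f B \<longleftrightarrow>
     liminf (\<lambda>N. (\<Sum>n=1..N. iter_measure M w f n (iter_preimage M f n B)) / of_nat N) = 0"

section \<open>Mean Li--Yorke chaos and absolute Cesaro boundedness\<close>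

definition mean_Li_Yorke_chaotic :: "'m set \<Rightarrow> ('m \<Rightarrow> 'm \<Rightarrow> real) \<Rightarrow> ('m \<Rightarrow> 'm) \<Rightarrow> bool" where
  "mean_Li_Yorke_chaotic X d g \<longleftrightarrow>
     (\<exists>S\<subseteq>X. uncountable S \<and> (\<forall>x\<in>S. \<forall>y\<in>S. x \<noteq> y \<longrightarrow>
        liminf (\<lambda>N. ereal ((\<Sum>n=1..N. d ((g ^^ n) x) ((g ^^ n) y)) / real N)) = 0 \<and>
        limsup (\<lambda>N. ereal ((\<Sum>n=1..N. d ((g ^^ n) x) ((g ^^ n) y)) / real N)) > 0))"

definition absolutely_Cesaro_bounded_in :: "('y \<Rightarrow> real) \<Rightarrow> ('y \<Rightarrow> 'y) \<Rightarrow> 'y set \<Rightarrow> bool" where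
  "absolutely_Cesaro_bounded_in nrm T Z \<longleftrightarrow>
     (\<exists>C::real. 0 < C \<and> (\<forall>y\<in>Z.
        (SUP N\<in>{1..}. ereal ((\<Sum>n=1..N. nrm ((T ^^ n) y)) / real N)) \<le> ereal (C * nrm y)))"

end

theory Submission
  imports Defs
begin

text \<open>
  Write \<open>\<nu>\<^sub>N(g) = (1/N) \<Sum>\<^bsub>n\<le>N\<^esub> \<integral> (g \<circ> f\<^sup>n) |w\<^sup>(\<^sup>n\<^sup>)| d\<mu>\<close>, a positive functional with
  \<open>\<nu>\<^sub>N(|\<phi>|) = (1/N) \<Sum>\<^bsub>n\<le>N\<^esub> \<parallel>T\<^sup>n \<phi>\<parallel>\<close> for the operator \<open>T\<close>.
  All three assertions are equivalent to the failure of a bound \<open>\<nu>\<^sub>N(\<chi>\<^sub>B) \<le> C \<mu>(B)\<close> over the sets \<open>B\<close> of finite measure with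
  \<open>liminf \<nu>\<^sub>N(\<chi>\<^sub>B) = 0\<close>. These sets are closed under measurable subsets, so such a bound extends by
  disjointification to every function supported in a countable union of them.
  Chaos amounts to a vector \<open>\<phi>\<close> with \<open>liminf \<nu>\<^sub>N(|\<phi>|) = 0\<close> and \<open>limsup \<nu>\<^sub>N(|\<phi>|) > 0\<close>. Some iterate
  \<open>T\<^sup>m \<phi>\<close> then has small norm and its superlevel sets are of the above kind, so the bound would force
  \<open>\<nu>\<^sub>N(|\<phi>|) \<rightarrow> 0\<close>. Conversely, without a bound, either some \<open>\<chi>\<^sub>B\<close> is such a vector, or all
  \<open>\<nu>\<^sub>N(\<chi>\<^sub>B)\<close> tend to \<open>0\<close> and a gliding hump
  \<open>\<Sum>\<^sub>k b\<^sub>k \<chi>(B\<^sub>k) / \<mu>(B\<^sub>k)\<close> with positive coefficients is one.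
\<close>

section \<open>Cesaro means of real sequences\<close>

text \<open>A nonnegative sequence has lower limit \<open>0\<close> unless that limit is positive,
  and the latter means that some \<open>e > 0\<close> bounds the sequence from below
  eventually.\<close>

lemma liminf_ereal_eq_0_iff:
  fixes r :: "nat \<Rightarrow> real"
  assumes "\<And>n. 0 \<le> r n"
  shows "liminf (\<lambda>n. ereal (r n)) = 0 \<longleftrightarrow> (\<forall>e>0. \<forall>m. \<exists>n\<ge>m. r n < e)"
proof -
  have "0 \<le> liminf (\<lambda>n. ereal (r n))"
    using assms by (intro Liminf_bounded) auto
  then have "liminf (\<lambda>n. ereal (r n)) = 0 \<longleftrightarrow> \<not> 0 < liminf (\<lambda>n. ereal (r n))" by auto
  also have "\<dots> \<longleftrightarrow> (\<forall>e>0. \<forall>m. \<exists>n\<ge>m. r n < e)"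
  proof -
    have "0 < liminf (\<lambda>n. ereal (r n)) \<longleftrightarrow> (\<exists>e>0. \<exists>m. \<forall>n\<ge>m. e \<le> r n)"
    proof
      assume "0 < liminf (\<lambda>n. ereal (r n))"
      then obtain y where y: "0 < y" "\<forall>\<^sub>F n in sequentially. y < ereal (r n)"
        using dense[of 0 "liminf (\<lambda>n. ereal (r n))"] less_LiminfD[of _ sequentially "\<lambda>n. ereal (r n)"]
        by metis
      from y obtain n where "y < ereal (r n)" by (auto simp: eventually_sequentially)
      with y(1) obtain e where e: "y = ereal e" by (cases y) auto
      from y show "\<exists>e>0. \<exists>m. \<forall>n\<ge>m. e \<le> r n"
        unfolding e eventually_sequentially by (intro exI[of _ e]) (auto intro: less_imp_le)
    next
      assume "\<exists>e>0. \<exists>m. \<forall>n\<ge>m. e \<le> r n"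
      then obtain e where e: "e > 0" "\<forall>\<^sub>F n in sequentially. ereal e \<le> ereal (r n)"
        by (auto simp: eventually_sequentially)
      have "ereal e \<le> liminf (\<lambda>n. ereal (r n))" by (rule Liminf_bounded[OF e(2)])
      with e(1) show "0 < liminf (\<lambda>n. ereal (r n))"
        by (metis ereal_less(2) order_less_le_trans)
    qed
    then show ?thesis by (auto simp: not_le)
  qed
  finally show ?thesis .
qed

lemma liminf_ennreal_eq_0_iff:
  fixes r :: "nat \<Rightarrow> ennreal"
  shows "liminf r = 0 \<longleftrightarrow> (\<forall>e>0. \<forall>m. \<exists>n\<ge>m. r n < ennreal e)"
proof
  assume l: "liminf r = 0"
  show "\<forall>e>0. \<forall>m. \<exists>n\<ge>m. r n < ennreal e"
  proof (intro allI impI, rule ccontr)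
    fix e :: real and m assume e: "0 < e" and "\<not> (\<exists>n\<ge>m. r n < ennreal e)"
    then have "\<forall>\<^sub>F n in sequentially. ennreal e \<le> r n"
      by (auto simp: eventually_sequentially not_less)
    then have "ennreal e \<le> liminf r" by (rule Liminf_bounded)
    with l e show False by simp
  qed
next
  assume *: "\<forall>e>0. \<forall>m. \<exists>n\<ge>m. r n < ennreal e"
  show "liminf r = 0"
  proof (rule ccontr)
    assume "liminf r \<noteq> 0"
    then have "0 < liminf r" by (simp add: zero_less_iff_neq_zero)
    then obtain y where y: "0 < y" "y < liminf r" using dense by blast
    then obtain e where e: "y = ennreal e" "0 < e" by (cases y) auto
    from y(2) have "\<forall>\<^sub>F n in sequentially. y < r n" by (rule less_LiminfD)
    with * e show False by (fastforce simp: eventually_sequentially)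
  qed
qed

text \<open>For a nonnegative sequence \<open>limsup \<le> 0\<close> squeezes both limits to
  \<open>0\<close>, so convergence to \<open>0\<close> fails exactly when the upper limit is
  positive.\<close>

lemma limsup_ereal_pos_iff:
  fixes r :: "nat \<Rightarrow> real"
  assumes "\<And>n. 0 \<le> r n"
  shows "0 < limsup (\<lambda>n. ereal (r n)) \<longleftrightarrow> \<not> r \<longlonglongrightarrow> 0"
proof -
  have 0: "0 \<le> liminf (\<lambda>n. ereal (r n))" using assms by (intro Liminf_bounded) auto
  have 1: "liminf (\<lambda>n. ereal (r n)) \<le> limsup (\<lambda>n. ereal (r n))" by (simp add: Liminf_le_Limsup)
  have "r \<longlonglongrightarrow> 0 \<longleftrightarrow> (\<lambda>n. ereal (r n)) \<longlonglongrightarrow> ereal 0" by simp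
  also have "\<dots> \<longleftrightarrow> limsup (\<lambda>n. ereal (r n)) \<le> 0"
  proof
    assume "(\<lambda>n. ereal (r n)) \<longlonglongrightarrow> ereal 0"
    then show "limsup (\<lambda>n. ereal (r n)) \<le> 0"
      using lim_imp_Limsup[of sequentially "\<lambda>n. ereal (r n)" "ereal 0"] by (simp add: zero_ereal_def)
  next
    assume "limsup (\<lambda>n. ereal (r n)) \<le> 0"
    with 0 1 have "liminf (\<lambda>n. ereal (r n)) = ereal 0" "limsup (\<lambda>n. ereal (r n)) = ereal 0"
      by (auto simp flip: zero_ereal_def)
    then show "(\<lambda>n. ereal (r n)) \<longlonglongrightarrow> ereal 0" by (intro Liminf_eq_Limsup) auto
  qed
  finally show ?thesis by (auto simp: not_le)
qed

definition cesaro_mean :: "(nat \<Rightarrow> real) \<Rightarrow> nat \<Rightarrow> real" where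
  "cesaro_mean a N = (\<Sum>n=1..N. a n) / real N"

lemma cesaro_mean_nonneg: "(\<And>n. 0 \<le> a n) \<Longrightarrow> 0 \<le> cesaro_mean a N"
  by (simp add: cesaro_mean_def sum_nonneg)

lemma sum_shift_cesaro:
  fixes a :: "nat \<Rightarrow> real"
  shows "(\<Sum>n=1..m+N. a n) = (\<Sum>n=1..m. a n) + (\<Sum>n=1..N. a (n + m))"
proof -
  have "(\<Sum>n=1..m+N. a n) = (\<Sum>n=1..m. a n) + (\<Sum>n=m+1..m+N. a n)"
    by (rule sum.ub_add_nat) simp
  also have "(\<Sum>n=m+1..m+N. a n) = (\<Sum>n=1..N. a (n + m))"
    using sum.shift_bounds_cl_nat_ivl[of a 1 m N] by (simp add: add.commute)
  finally show ?thesis .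
qed

text \<open>Dropping the first \<open>m\<close> terms of a nonnegative sequence lowers the sum,
  while the divisor shrinks from \<open>m + N\<close> to \<open>N\<close>. This costs at most the
  factor \<open>1 + m\<close> once \<open>N \<ge> 1\<close>.\<close>

lemma cesaro_mean_shift_frequently_small:
  fixes a :: "nat \<Rightarrow> real"
  assumes nonneg: "\<And>n. 0 \<le> a n"
    and small: "\<forall>e>0. \<forall>m. \<exists>n\<ge>m. cesaro_mean a n < e"
    and "0 < e"
  shows "\<exists>N\<ge>k. cesaro_mean (\<lambda>n. a (n + m)) N < e"
proof -
  \<comment> \<open>The summand \<open>1\<close> in the lower bound ensures
    \<open>N' - m \<ge> 1\<close>; the divisor \<open>1 + m\<close> pays for the change of
    length.\<close>
  obtain N' where N': "N' \<ge> k + m + 1" "cesaro_mean a N' < e / (1 + real m)"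
    using small \<open>0 < e\<close> by (metis divide_pos_pos add_pos_nonneg of_nat_0_le_iff zero_less_one)
  define N where "N = N' - m"
  have N: "N' = m + N" "N \<ge> k" "N \<ge> 1" using N' by (auto simp: N_def)
  have "(\<Sum>n=1..N. a (n + m)) \<le> (\<Sum>n=1..N'. a n)"
    unfolding N(1) sum_shift_cesaro using nonneg by (simp add: sum_nonneg)
  also have "\<dots> = cesaro_mean a N' * real N'"
    using N by (simp add: cesaro_mean_def)
  also have "\<dots> \<le> cesaro_mean a N' * ((1 + real m) * real N)"
  proof -
    have "real m \<le> real m * real N" using N(3) by (simp add: mult_le_cancel_left1)
    then have "real N' \<le> (1 + real m) * real N" using N by (simp add: algebra_simps)
    then show ?thesis by (intro mult_left_mono cesaro_mean_nonneg nonneg)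
  qed
  also have "\<dots> < e / (1 + real m) * ((1 + real m) * real N)"
    using N'(2) N(3) by (intro mult_strict_right_mono) auto
  also have "\<dots> = e * real N" by (simp add: field_simps)
  finally have "cesaro_mean (\<lambda>n. a (n + m)) N < e"
    using N(3) by (simp add: cesaro_mean_def divide_less_eq)
  with N(2) show ?thesis by blast
qed

text \<open>One small mean contains one small term \<open>a m\<close>. The shift bound started at
  this \<open>m\<close> controls every later mean by \<open>C * a m\<close>, and the first
  \<open>m\<close> terms contribute only a constant divided by \<open>N\<close>.\<close>

lemma cesaro_mean_tendsto_0:
  fixes a :: "nat \<Rightarrow> real"
  assumes nonneg: "\<And>n. 0 \<le> a n"
    and small: "\<forall>e>0. \<forall>m. \<exists>n\<ge>m. cesaro_mean a n < e"
    and shift: "\<And>m N. 1 \<le> N \<Longrightarrow> cesaro_mean (\<lambda>n. a (n + m)) N \<le> C * a m"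
    and "0 < C"
  shows "cesaro_mean a \<longlonglongrightarrow> 0"
proof (rule LIMSEQ_I)
  fix e :: real assume e: "0 < e"
  \<comment> \<open>With this choice \<open>C * d = e / 2\<close>; the other half is reserved for
    the initial segment \<open>s / N\<close>.\<close>
  define d where "d = e / (2 * C)"
  have d: "0 < d" using e \<open>0 < C\<close> by (simp add: d_def)
  obtain N0 where N0: "N0 \<ge> 1" "cesaro_mean a N0 < d" using small d by blast
  have "\<exists>m\<in>{1..N0}. a m < d"
  proof (rule ccontr)
    assume "\<not> (\<exists>m\<in>{1..N0}. a m < d)"
    then have "(\<Sum>n=1..N0. d) \<le> (\<Sum>n=1..N0. a n)" by (intro sum_mono) (auto simp: not_less)
    then have "d * real N0 \<le> (\<Sum>n=1..N0. a n)" by (simp add: mult.commute)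
    with N0 show False by (simp add: cesaro_mean_def divide_less_eq)
  qed
  then obtain m where m: "a m < d" by blast
  define s where "s = (\<Sum>n=1..m. a n)"
  have "(\<lambda>N. s / real N) \<longlonglongrightarrow> 0" by (rule lim_const_over_n)
  then obtain k where k: "\<And>N. N \<ge> k \<Longrightarrow> s / real N < e / 2"
    using e by (metis (no_types, lifting) eventually_sequentially half_gt_zero order_tendstoD(2))
  show "\<exists>n0. \<forall>N\<ge>n0. norm (cesaro_mean a N - 0) < e"
  proof (intro exI[of _ "k + m + 1"] allI impI)
    fix N assume N: "k + m + 1 \<le> N"
    define L where "L = N - m"
    have L: "N = m + L" "1 \<le> L" using N by (auto simp: L_def)
    have "(\<Sum>n=1..L. a (n + m)) \<le> C * a m * real L"
      using shift[OF L(2), of m] L by (simp add: cesaro_mean_def divide_le_eq)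
    also have "\<dots> \<le> C * d * real N"
      using m L nonneg[of m] \<open>0 < C\<close> d by (intro mult_mono) auto
    also have "C * d = e / 2" using \<open>0 < C\<close> by (simp add: d_def)
    finally have "(\<Sum>n=1..N. a n) \<le> s + e / 2 * real N"
      unfolding L(1) sum_shift_cesaro s_def by simp
    then have "cesaro_mean a N \<le> (s + e / 2 * real N) / real N"
      unfolding cesaro_mean_def by (rule divide_right_mono) simp
    also have "\<dots> = s / real N + e / 2"
      using L by (subst add_divide_distrib) (simp del: times_divide_eq_left)
    also have "\<dots> < e" using k[of N] N by linarith
    finally show "norm (cesaro_mean a N - 0) < e"
      using cesaro_mean_nonneg[of a N, OF nonneg] by simp
  qed
qed

section \<open>A gliding hump construction\<close>

text \<open>The weights are chosen one after another. At a time \<open>m k\<close> the humps up to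
  \<open>k\<close> are jointly small because each tends to \<open>0\<close>, and all later ones are
  small because their weights are tiny compared with the crude bound \<open>K (m k)\<close>.
  Unboundedness of \<open>p\<close> still lets each weighted hump exceed \<open>k\<close> at some
  other time.\<close>

lemma gliding_hump:
  fixes p :: "nat \<Rightarrow> 'b \<Rightarrow> real"
  assumes nonneg: "\<And>N h. h \<in> H \<Longrightarrow> 0 \<le> p N h"
    and bound: "\<And>N h. h \<in> H \<Longrightarrow> p N h \<le> K N"
    and null: "\<And>h. h \<in> H \<Longrightarrow> (\<lambda>N. p N h) \<longlonglongrightarrow> 0"
    and unbounded: "\<And>C. \<exists>h\<in>H. \<exists>N\<ge>1. C < p N h"
  obtains b :: "nat \<Rightarrow> real" and h where "\<And>k. 0 < b k" "\<And>k. h k \<in> H" "summable b"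
    "\<And>N. summable (\<lambda>k. b k * p N (h k))"
    "\<forall>e>0. \<forall>m. \<exists>N\<ge>m. (\<Sum>k. b k * p N (h k)) < e"
    "\<And>k. \<exists>N\<ge>1. real k < b k * p N (h k)"
proof -
  \<comment> \<open>A state consists of the current weight \<open>b\<close>, the hump
    \<open>h\<close>, a good time \<open>m\<close> and the partial sum \<open>G\<close> of all humps
    so far. \<open>P\<close> is the invariant and \<open>Q\<close> the transition: the new weight is
    at most half the old one and negligible at the previous good time. The clause for
    \<open>k = 0\<close> anchors the recursion for \<open>G\<close>.\<close>
  define P :: "nat \<Rightarrow> real \<times> 'b \<times> nat \<times> (nat \<Rightarrow> real) \<Rightarrow> bool" where
    "P k = (\<lambda>(b, h, m, G). 0 < b \<and> h \<in> H \<and> G \<longlonglongrightarrow> 0 \<and> k \<le> m \<and> G m < (1/2)^k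
      \<and> (\<exists>N\<ge>1. real k < b * p N h) \<and> (k = 0 \<longrightarrow> G = (\<lambda>N. b * p N h)))" for k
  define Q :: "nat \<Rightarrow> real \<times> 'b \<times> nat \<times> (nat \<Rightarrow> real) \<Rightarrow> real \<times> 'b \<times> nat \<times> (nat \<Rightarrow> real) \<Rightarrow> bool" where
    "Q k = (\<lambda>(b, h, m, G) (b', h', m', G'). b' \<le> b / 2 \<and> b' * K m \<le> (1/2)^k
      \<and> G' = (\<lambda>N. G N + b' * p N h'))" for k
  obtain h0 where "h0 \<in> H" using unbounded by blast
  then have K: "0 \<le> K N" for N using nonneg[of h0 N] bound[of h0 N] by linarith
  have step: "\<exists>h m. h \<in> H \<and> (\<lambda>N. G N + b * p N h) \<longlonglongrightarrow> 0 \<and> k \<le> m \<and> G m + b * p m h < (1/2)^k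
      \<and> (\<exists>N\<ge>1. real k < b * p N h)" if b: "0 < b" and G: "G \<longlonglongrightarrow> 0" for b G k
  proof -
    \<comment> \<open>The hump is picked after its weight \<open>b\<close>, so that its peak can
      compensate for a small \<open>b\<close>.\<close>
    obtain h N where h: "h \<in> H" "N \<ge> 1" "real k / b < p N h" using unbounded by blast
    have lim: "(\<lambda>N. G N + b * p N h) \<longlonglongrightarrow> 0"
      using tendsto_add[OF G tendsto_mult_left[OF null[OF h(1)], of b]] by simp
    then have "\<forall>\<^sub>F N in sequentially. G N + b * p N h < (1/2)^k"
      by (rule order_tendstoD) simp
    then obtain m where "m \<ge> k" "G m + b * p m h < (1/2)^k"
      by (auto simp: eventually_sequentially) (metis nle_le)
    with h lim b show ?thesis by (auto simp: field_simps)
  qed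
  have "\<exists>s. \<forall>k. P k (s k) \<and> Q k (s k) (s (Suc k))"
  proof (rule dependent_nat_choice)
    show "\<exists>x. P 0 x"
    proof -
      obtain h m where "h \<in> H" "(\<lambda>N. p N h) \<longlonglongrightarrow> 0" "p m h < 1" "\<exists>N\<ge>1. 0 < p N h"
        using step[of 1 "\<lambda>_. 0" 0] by auto
      then have "P 0 (1, h, m, \<lambda>N. p N h)" by (auto simp: P_def)
      then show ?thesis ..
    qed
  next
    fix x k assume "P k x"
    obtain b h m G where x: "x = (b, h, m, G)" by (cases x)
    have b: "0 < b" and G: "G \<longlonglongrightarrow> 0" using \<open>P k x\<close> by (auto simp: P_def x)
    \<comment> \<open>The first bound gives geometric decay, the second makes the hump negligible at
      time \<open>m\<close>. The denominator \<open>1 + K m\<close> stays positive even if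
      \<open>K m = 0\<close>.\<close>
    define b' where "b' = min (b / 2) ((1/2)^k / (1 + K m))"
    have b': "0 < b'" "b' \<le> b / 2" "b' \<le> (1/2)^k / (1 + K m)"
      unfolding b'_def using b K[of m]
      by (auto simp only: min.cobounded1 min.cobounded2) (simp add: add_pos_nonneg)
    have "b' * K m \<le> b' * (1 + K m)" using b' by simp
    also have "\<dots> \<le> (1/2)^k" using b'(3) K[of m] by (simp add: pos_le_divide_eq)
    finally have bK: "b' * K m \<le> (1/2)^k" .
    from step[OF b'(1) G, of "Suc k"] b' bK show "\<exists>y. P (Suc k) y \<and> Q k x y"
      unfolding P_def Q_def x by fastforce
  qed
  then obtain s where s: "\<And>k. P k (s k)" "\<And>k. Q k (s k) (s (Suc k))" by blast
  define b where "b k = fst (s k)" for k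
  define h where "h k = fst (snd (s k))" for k
  define m where "m k = fst (snd (snd (s k)))" for k
  define G where "G k = snd (snd (snd (s k)))" for k
  have s_eq: "s k = (b k, h k, m k, G k)" for k by (simp add: b_def h_def m_def G_def)
  have b: "0 < b k" and h: "h k \<in> H" and m: "k \<le> m k" and Gm: "G k (m k) < (1/2)^k"
    and large: "\<exists>N\<ge>1. real k < b k * p N (h k)" and G0: "G 0 = (\<lambda>N. b 0 * p N (h 0))" for k
    using s(1)[of k] s(1)[of 0] by (auto simp: P_def s_eq)
  have b2: "b (Suc k) \<le> b k / 2" and bK: "b (Suc k) * K (m k) \<le> (1/2)^k"
    and GS: "G (Suc k) = (\<lambda>N. G k N + b (Suc k) * p N (h (Suc k)))" for k
    using s(2)[of k] by (auto simp: Q_def s_eq)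
  have G: "G k N = (\<Sum>j<Suc k. b j * p N (h j))" for k N
    by (induction k) (simp_all add: G0 GS)
  have geo: "b (j + k) \<le> b k * (1/2)^j" for j k
  proof (induction j)
    case (Suc j)
    then show ?case using b2[of "j + k"] by simp
  qed simp
  have sum_b: "summable b"
    by (rule summable_comparison_test'[where g="\<lambda>j. b 0 * (1/2)^j" and N=0])
       (use b geo[of _ 0] in \<open>auto simp: less_imp_le intro!: summable_mult summable_geometric\<close>)
  have sum_bp: "summable (\<lambda>k. b k * p N (h k))" for N
  proof (rule summable_comparison_test'[where g="\<lambda>k. b k * K N" and N=0])
    show "summable (\<lambda>k. b k * K N)" using sum_b by (rule summable_mult2)
    show "norm (b n * p N (h n)) \<le> b n * K N" for n
      using b[of n] nonneg[OF h, of N n] bound[OF h, of N n] by (simp add: mult_left_mono)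
  qed
  \<comment> \<open>The head up to \<open>k\<close> is \<open>G k (m k) < (1/2)^k\<close>. The tail
    is dominated by \<open>(1/2)^k\<close> times a geometric series with sum \<open>2\<close>,
    whence the factor \<open>3\<close>.\<close>
  have est: "(\<Sum>j. b j * p (m k) (h j)) < 3 * (1/2)^k" for k
  proof -
    have le: "b (j + Suc k) * p (m k) (h (j + Suc k)) \<le> (1/2)^k * (1/2)^j" for j
    proof -
      have "b (j + Suc k) * p (m k) (h (j + Suc k)) \<le> (b (Suc k) * (1/2)^j) * K (m k)"
        using b[of "j + Suc k"] b[of "Suc k"] geo[of j "Suc k"] nonneg[OF h, of "m k"]
          bound[OF h, of "m k"]
        by (intro mult_mono) auto
      also have "\<dots> = (b (Suc k) * K (m k)) * (1/2)^j" by simp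
      also have "\<dots> \<le> (1/2)^k * (1/2)^j" by (intro mult_right_mono bK) simp
      finally show ?thesis .
    qed
    have "(\<Sum>j. b j * p (m k) (h j)) = (\<Sum>j. b (j + Suc k) * p (m k) (h (j + Suc k))) + G k (m k)"
      unfolding G by (rule suminf_split_initial_segment[OF sum_bp])
    also have "(\<Sum>j. b (j + Suc k) * p (m k) (h (j + Suc k))) \<le> (\<Sum>j. (1/2)^k * (1/2)^j)"
      by (intro suminf_le le summable_mult summable_geometric
          summable_ignore_initial_segment[OF sum_bp]) simp
    also have "(\<Sum>j. (1/2::real)^k * (1/2)^j) = (1/2)^k * 2"
      by (subst suminf_mult) (auto simp: suminf_geometric summable_geometric)
    finally show ?thesis using Gm[of k] by linarith
  qed
  have freq: "\<forall>e>0. \<forall>n. \<exists>N\<ge>n. (\<Sum>k. b k * p N (h k)) < e"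
  proof (intro allI impI)
    fix e :: real and n assume "0 < e"
    have "(\<lambda>k. 3 * (1/2::real)^k) \<longlonglongrightarrow> 3 * 0"
      by (intro tendsto_intros LIMSEQ_realpow_zero) auto
    then have "\<forall>\<^sub>F k in sequentially. 3 * (1/2::real)^k < e"
      by (rule order_tendstoD) (simp add: \<open>0 < e\<close>)
    then obtain k where "k \<ge> n" "3 * (1/2::real)^k < e"
      by (auto simp: eventually_sequentially) (metis nle_le)
    with est[of k] m[of k] show "\<exists>N\<ge>n. (\<Sum>k. b k * p N (h k)) < e"
      by (intro exI[of _ "m k"]) auto
  qed
  show thesis using that[OF b h sum_b sum_bp freq large] .
qed

section \<open>The averaged functionals\<close>

context weighted_composition
begin

lemma funpow_measurable [measurable]: "f ^^ n \<in> measurable M M"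
  using f_measurable by (rule measurable_compose_n)

lemma iter_weight_measurable [measurable]: "iter_weight w f n \<in> borel_measurable M"
proof -
  have "(\<lambda>x. w ((f ^^ i) x)) \<in> borel_measurable M" for i
    using measurable_compose[OF funpow_measurable w_measurable] by (simp add: comp_def)
  then show ?thesis unfolding iter_weight_def by (intro borel_measurable_prod)
qed

text \<open>Cocycle identity: the product of weights along an orbit splits at the
  \<open>n\<close>-th point.\<close>

lemma iter_weight_add: "iter_weight w f (n + m) x = iter_weight w f m ((f ^^ n) x) * iter_weight w f n x"
proof -
  have "iter_weight w f (n + m) x = (\<Prod>i<n. w ((f ^^ i) x)) * (\<Prod>i<m. w ((f ^^ (n + i)) x))"
    unfolding iter_weight_def
    by (induction m) (simp_all add: mult.assoc)
  then show ?thesis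
    by (simp add: iter_weight_def funpow_add add.commute[of n] mult.commute)
qed

text \<open>Integration against the image under \<open>f ^^ n\<close> of the measure with density
  \<open>norm (iter_weight w f n x)\<close>. For an indicator of \<open>B\<close> this is
  \<mu>_n(f^{-n}(B)), and for the norm of an integrable \<phi> it is the norm of the
  \<open>n\<close>-th iterate of \<phi>.\<close>

definition orbit_integral :: "nat \<Rightarrow> ('a \<Rightarrow> ennreal) \<Rightarrow> ennreal" where
  "orbit_integral n g = (\<integral>\<^sup>+x. g ((f ^^ n) x) * ennreal (norm (iter_weight w f n x)) \<partial>M)"

text \<open>For \<open>N = 0\<close> the value is \<open>0\<close>, which lets upper bounds be
  stated for all \<open>N\<close>.\<close>

definition mean_integral :: "nat \<Rightarrow> ('a \<Rightarrow> ennreal) \<Rightarrow> ennreal" where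
  "mean_integral N g = (\<Sum>n=1..N. orbit_integral n g) / of_nat N"

lemma funpow_space: "x \<in> space M \<Longrightarrow> (f ^^ n) x \<in> space M"
  by (rule measurable_space[OF funpow_measurable])

text \<open>Splitting off one application of \<open>f\<close> and one weight factor, each step costs
  the constant \<open>c\<close> of the one-step estimate.\<close>

lemma orbit_integral_bound:
  "\<exists>c>0. \<forall>n. \<forall>g\<in>borel_measurable M. orbit_integral n g \<le> ennreal (c ^ n) * (\<integral>\<^sup>+x. g x \<partial>M)"
proof -
  obtain c :: real where c: "0 < c" "\<And>g. g \<in> borel_measurable M \<Longrightarrow>
     (\<integral>\<^sup>+x. g (f x) * ennreal (norm (w x)) \<partial>M) \<le> ennreal c * (\<integral>\<^sup>+x. g x \<partial>M)"
    using nn_integral_comp_bound by blast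
  have "orbit_integral n g \<le> ennreal (c ^ n) * (\<integral>\<^sup>+x. g x \<partial>M)"
    if [measurable]: "g \<in> borel_measurable M" for n g
  proof (induction n)
    case 0
    then show ?case by (simp add: orbit_integral_def iter_weight_def)
  next
    case (Suc n)
    have "orbit_integral (Suc n) g
      = (\<integral>\<^sup>+x. (\<lambda>x. g ((f ^^ n) x) * ennreal (norm (iter_weight w f n x))) (f x) * ennreal (norm (w x)) \<partial>M)"
      unfolding orbit_integral_def
      using iter_weight_add[of 1 n]
      by (simp add: funpow_swap1 norm_mult ennreal_mult mult.assoc iter_weight_def[of w f "Suc 0"])
    also have "\<dots> \<le> ennreal c * orbit_integral n g"
      unfolding orbit_integral_def by (rule c(2)) measurable
    also have "\<dots> \<le> ennreal c * (ennreal (c ^ n) * (\<integral>\<^sup>+x. g x \<partial>M))"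
      by (intro mult_left_mono Suc) simp
    also have "\<dots> = ennreal (c ^ Suc n) * (\<integral>\<^sup>+x. g x \<partial>M)"
      using c(1) by (simp add: ennreal_mult mult.assoc)
    finally show ?case .
  qed
  with c(1) show ?thesis by blast
qed

text \<open>The constant may grow with \<open>N\<close>. It gives continuity of each single mean in
  the L1 norm and shows that null sets are invisible to the means.\<close>

lemma mean_integral_bound:
  "\<exists>K. \<forall>N. 0 \<le> K N \<and>
    (\<forall>g\<in>borel_measurable M. mean_integral N g \<le> ennreal (K N) * (\<integral>\<^sup>+x. g x \<partial>M))"
proof -
  obtain c :: real where c: "0 < c"
    "\<And>n g. g \<in> borel_measurable M \<Longrightarrow> orbit_integral n g \<le> ennreal (c ^ n) * (\<integral>\<^sup>+x. g x \<partial>M)"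
    using orbit_integral_bound by blast
  show ?thesis
  proof (intro exI allI conjI ballI)
    fix N and g :: "'a \<Rightarrow> ennreal" assume g: "g \<in> borel_measurable M"
    \<comment> \<open>Division by \<open>N \<ge> 1\<close> only decreases the sum.\<close>
    have "mean_integral N g \<le> (\<Sum>n=1..N. orbit_integral n g)"
    proof (cases N)
      case (Suc k)
      then have N: "(1::ennreal) \<le> of_nat N" by simp
      from mult_left_mono[OF N, of "\<Sum>n=1..N. orbit_integral n g"] order_less_le_trans[OF zero_less_one N]
      show ?thesis
        unfolding mean_integral_def by (intro divide_le_posI_ennreal) (simp_all add: mult.commute)
    qed (simp add: mean_integral_def)
    also have "\<dots> \<le> (\<Sum>n=1..N. ennreal (c ^ n) * (\<integral>\<^sup>+x. g x \<partial>M))"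
      by (intro sum_mono c(2) g)
    also have "\<dots> = ennreal (\<Sum>n=1..N. c ^ n) * (\<integral>\<^sup>+x. g x \<partial>M)"
      using c(1) by (simp add: sum_distrib_right flip: sum_ennreal)
    finally show "mean_integral N g \<le> ennreal (\<Sum>n=1..N. c ^ n) * (\<integral>\<^sup>+x. g x \<partial>M)" .
  next
    show "0 \<le> (\<Sum>n=1..N. c ^ n)" for N using c(1) by (simp add: sum_nonneg)
  qed
qed

lemma orbit_integral_mono:
  "(\<And>x. x \<in> space M \<Longrightarrow> g x \<le> h x) \<Longrightarrow> orbit_integral n g \<le> orbit_integral n h"
  unfolding orbit_integral_def by (intro nn_integral_mono mult_right_mono) (auto simp: funpow_space)

lemma mean_integral_mono:
  "(\<And>x. x \<in> space M \<Longrightarrow> g x \<le> h x) \<Longrightarrow> mean_integral N g \<le> mean_integral N h"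
  unfolding mean_integral_def by (intro divide_right_mono_ennreal sum_mono orbit_integral_mono)

lemma mean_integral_cong:
  "(\<And>x. x \<in> space M \<Longrightarrow> g x = h x) \<Longrightarrow> mean_integral N g = mean_integral N h"
  by (intro antisym mean_integral_mono) auto

lemma mean_integral_cmult:
  assumes [measurable]: "g \<in> borel_measurable M"
  shows "mean_integral N (\<lambda>x. c * g x) = c * mean_integral N g"
  unfolding mean_integral_def orbit_integral_def
  by (simp add: mult.assoc nn_integral_cmult ennreal_times_divide flip: sum_distrib_left)

lemma mean_integral_add:
  assumes [measurable]: "g \<in> borel_measurable M" "h \<in> borel_measurable M"
  shows "mean_integral N (\<lambda>x. g x + h x) = mean_integral N g + mean_integral N h"
  unfolding mean_integral_def orbit_integral_def
  by (simp add: distrib_right nn_integral_add sum.distrib add_divide_distrib_ennreal)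

lemma mean_integral_suminf:
  assumes [measurable]: "\<And>i. g i \<in> borel_measurable M"
  shows "mean_integral N (\<lambda>x. \<Sum>i. g i x) = (\<Sum>i. mean_integral N (g i))"
proof -
  have "orbit_integral n (\<lambda>x. \<Sum>i. g i x) = (\<Sum>i. orbit_integral n (g i))" for n
    unfolding orbit_integral_def by (subst nn_integral_suminf[symmetric]) simp_all
  then show ?thesis
    unfolding mean_integral_def
    by (simp add: suminf_sum[OF summableI])
qed

lemma mean_integral_SUP:
  assumes [measurable]: "\<And>i. g i \<in> borel_measurable M" and inc: "incseq g"
  shows "mean_integral N (\<lambda>x. SUP i. g i x) = (SUP i. mean_integral N (g i))"
proof -
  have inc': "incseq (\<lambda>i. orbit_integral n (g i))" for n
    using inc by (auto simp: incseq_def le_fun_def intro!: orbit_integral_mono)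
  have "orbit_integral n (\<lambda>x. SUP i. g i x) = (SUP i. orbit_integral n (g i))" for n
    unfolding orbit_integral_def SUP_mult_right_ennreal
    by (rule nn_integral_monotone_convergence_SUP)
       (use inc in \<open>auto simp: incseq_def le_fun_def intro!: mult_right_mono\<close>)
  then have "mean_integral N (\<lambda>x. SUP i. g i x) = (SUP i. \<Sum>n=1..N. orbit_integral n (g i)) / of_nat N"
    unfolding mean_integral_def by (simp only: ennreal_SUP_sum[OF inc'])
  then show ?thesis by (simp only: SUP_divide_ennreal mean_integral_def)
qed

text \<open>Preimages of null sets under \<open>f ^^ n\<close> need not be null, but the weights
  vanish almost everywhere on them: \<open>mean_integral_bound\<close> annihilates every function
  with integral \<open>0\<close>.\<close>

lemma mean_integral_cong_AE:
  assumes [measurable]: "g \<in> borel_measurable M" "h \<in> borel_measurable M"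
    and eq: "AE x in M. g x = h x"
  shows "mean_integral N g = mean_integral N h"
proof -
  obtain K :: "nat \<Rightarrow> real" where K:
    "\<And>N g. g \<in> borel_measurable M \<Longrightarrow> mean_integral N g \<le> ennreal (K N) * (\<integral>\<^sup>+x. g x \<partial>M)"
    using mean_integral_bound by metis
  \<comment> \<open>The value \<open>top\<close> on the exceptional set makes
    \<open>g \<le> h + z\<close> and \<open>h \<le> g + z\<close> hold pointwise, however large the
    difference is.\<close>
  define z :: "'a \<Rightarrow> ennreal" where "z = (\<lambda>x. if g x = h x then 0 else top)"
  have z [measurable]: "z \<in> borel_measurable M" unfolding z_def by measurable
  have "(\<integral>\<^sup>+x. z x \<partial>M) = 0"
    using eq by (subst nn_integral_0_iff_AE) (auto simp: z_def)
  then have 0: "mean_integral N z = 0" using K[OF z, of N] by simp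
  have "mean_integral N g \<le> mean_integral N (\<lambda>x. h x + z x)"
    "mean_integral N h \<le> mean_integral N (\<lambda>x. g x + z x)"
    by (auto intro!: mean_integral_mono simp: z_def)
  then show ?thesis using 0 by (simp add: mean_integral_add)
qed

section \<open>Sets whose means are frequently small\<close>

lemma iter_measure_preimage:
  "iter_measure M w f n (iter_preimage M f n B) = orbit_integral n (indicator B)"
  unfolding iter_measure_def iter_preimage_def orbit_integral_def
  by (intro nn_integral_cong) (auto simp: indicator_def)

text \<open>The sets whose indicators generate the closed subspace of the theorem. Null sets are
  included.\<close>

definition proximal_sets :: "'a set set" where
  "proximal_sets = {B. B \<in> sets M \<and> emeasure M B < \<infinity> \<and> liminf_mean_zero M w f B}"

lemma liminf_mean_zero_iff:
  "liminf_mean_zero M w f B \<longleftrightarrow> liminf (\<lambda>N. mean_integral N (indicator B)) = 0"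
  by (simp add: liminf_mean_zero_def iter_measure_preimage mean_integral_def)

text \<open>Both the measure and the means are monotone. This heredity is what allows a countable
  union of such sets to be cut into disjoint pieces of the same kind.\<close>

lemma proximal_sets_subset:
  assumes "B \<in> proximal_sets" "A \<in> sets M" "A \<subseteq> B"
  shows "A \<in> proximal_sets"
proof -
  have "liminf (\<lambda>N. mean_integral N (indicator A)) \<le> liminf (\<lambda>N. mean_integral N (indicator B))"
    using assms(3)
    by (intro Liminf_mono always_eventually allI mean_integral_mono) (auto simp: indicator_def)
  moreover have "emeasure M A \<le> emeasure M B"
    using assms by (intro emeasure_mono) (auto simp: proximal_sets_def)
  ultimately show ?thesis
    using assms by (auto simp: proximal_sets_def liminf_mean_zero_iff)
qed

text \<open>The set bound passes to measurable subsets of the union by countable additivity over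
  disjoint pieces, and from there to functions by the usual approximation with simple
  functions.\<close>

lemma mean_integral_dominated:
  assumes dom: "\<And>B. B \<in> proximal_sets \<Longrightarrow> mean_integral N (indicator B) \<le> C * emeasure M B"
    and U: "\<And>i. U i \<in> proximal_sets"
    and g: "g \<in> borel_measurable M"
    and supp: "\<And>x. x \<in> space M \<Longrightarrow> x \<notin> (\<Union>i::nat. U i) \<Longrightarrow> g x = 0"
  shows "mean_integral N g \<le> C * (\<integral>\<^sup>+x. g x \<partial>M)"
proof -
  define V where "V = (\<Union>i. U i)"
  have [measurable]: "U i \<in> sets M" for i using U by (auto simp: proximal_sets_def)
  have V [measurable]: "V \<in> sets M" unfolding V_def by measurable
  have D [measurable]: "disjointed U i \<in> sets M" for i
    by (rule sets.range_disjointed_sets[THEN range_subsetD]) auto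
  \<comment> \<open>The support condition is moved into the factor \<open>indicator V x\<close>, so
    that the induction runs over arbitrary measurable functions.\<close>
  have "mean_integral N (\<lambda>x. g x * indicator V x) \<le> C * (\<integral>\<^sup>+x. g x * indicator V x \<partial>M)"
    using g
  proof (induction rule: borel_measurable_induct)
    case (cong f g)
    then show ?case
      using mean_integral_cong[of "\<lambda>x. f x * indicator V x" "\<lambda>x. g x * indicator V x" N]
        nn_integral_cong[of M "\<lambda>x. f x * indicator V x" "\<lambda>x. g x * indicator V x"] by simp
  next
    case [measurable]: (set A)
    \<comment> \<open>Each piece lies inside a single \<open>U i\<close>, hence is itself proximal
      and obeys \<open>dom\<close>.\<close>
    let ?A = "\<lambda>i. A \<inter> disjointed U i"
    have "disjoint_family ?A"
      using disjoint_family_disjointed[of U] by (auto simp: disjoint_family_on_def)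
    moreover have "(\<Union>i. ?A i) = A \<inter> V"
      unfolding V_def by (metis Int_UN_distrib UN_disjointed_eq)
    ultimately have A: "indicator A x * indicator V x = (\<Sum>i. indicator (?A i) x :: ennreal)" for x
      using suminf_indicator[of ?A x] by (simp add: indicator_inter_arith)
    have "mean_integral N (indicator (?A i)) \<le> C * emeasure M (?A i)" for i
      using disjointed_subset[of U i] by (intro dom proximal_sets_subset[OF U[of i]]) auto
    then have "mean_integral N (\<lambda>x. \<Sum>i. indicator (?A i) x) \<le> (\<Sum>i. C * emeasure M (?A i))"
      by (subst mean_integral_suminf) (auto intro!: suminf_le simp del: ennreal_suminf_cmult)
    also have "\<dots> = C * (\<integral>\<^sup>+x. (\<Sum>i. indicator (?A i) x) \<partial>M)"
      by (subst nn_integral_suminf) auto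
    finally show ?case by (simp add: A)
  next
    case (mult u c)
    note [measurable] = mult.hyps(2)
    have "mean_integral N (\<lambda>x. c * u x * indicator V x) = c * mean_integral N (\<lambda>x. u x * indicator V x)"
      by (simp add: mean_integral_cmult mult.assoc)
    also have "\<dots> \<le> c * (C * (\<integral>\<^sup>+x. u x * indicator V x \<partial>M))"
      by (intro mult_left_mono mult.IH) simp
    also have "\<dots> = C * (\<integral>\<^sup>+x. c * u x * indicator V x \<partial>M)"
      by (simp add: nn_integral_cmult mult.assoc mult.left_commute)
    finally show ?case .
  next
    case (add u v)
    note [measurable] = add.hyps(1,3)
    show ?case
      using add_mono[OF add.IH(2,1)]
        mean_integral_add[of "\<lambda>x. v x * indicator V x" "\<lambda>x. u x * indicator V x" N]
        nn_integral_add[of "\<lambda>x. v x * indicator V x" M "\<lambda>x. u x * indicator V x"]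
      by (simp add: distrib_right distrib_left)
  next
    case (seq W)
    note [measurable] = seq.hyps(1)
    have inc: "incseq (\<lambda>i x. W i x * indicator V x)"
      using seq by (auto simp: incseq_def le_fun_def intro!: mult_right_mono)
    have eq: "(SUP i. W i) x * indicator V x = (SUP i. W i x * indicator V x)" for x
      by (simp add: SUP_apply SUP_mult_right_ennreal image_comp)
    show ?case
      unfolding eq
      by (subst mean_integral_SUP[OF _ inc] nn_integral_monotone_convergence_SUP[OF inc], simp)+
         (auto intro!: SUP_least order_trans[OF seq.IH] mult_left_mono SUP_upper)
  qed
  moreover have eq: "x \<in> space M \<Longrightarrow> g x * indicator V x = g x" for x
    using supp[of x] by (auto simp: V_def indicator_def)
  ultimately show ?thesis
    by (simp add: eq cong: mean_integral_cong nn_integral_cong_simp)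
qed

section \<open>Orbits in the space of integrable functions\<close>

text \<open>For integrable \<phi> this is the norm of the \<open>n\<close>-th iterate of the class
  of \<phi>, written on functions to avoid the representatives chosen by
  \<open>L1_rep\<close>.\<close>

definition orbit_norm :: "('a \<Rightarrow> 'k) \<Rightarrow> nat \<Rightarrow> real" where
  "orbit_norm \<phi> n = (\<integral>x. norm (\<phi> ((f ^^ n) x) * iter_weight w f n x) \<partial>M)"

lemma orbit_norm_nonneg [simp]: "0 \<le> orbit_norm \<phi> n"
  by (simp add: orbit_norm_def)

lemma orbit_norm_0: "orbit_norm \<phi> 0 = (\<integral>x. norm (\<phi> x) \<partial>M)"
  by (simp add: orbit_norm_def iter_weight_def)

lemma iter_weight_Suc: "iter_weight w f (Suc n) x = iter_weight w f n (f x) * w x"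
  unfolding iter_weight_def by (simp only: prod.lessThan_Suc_shift) (simp add: funpow_swap1 mult.commute)

lemma integrable_orbit:
  "integrable M \<phi> \<Longrightarrow> integrable M (\<lambda>x. \<phi> ((f ^^ n) x) * iter_weight w f n x)"
proof (induction n)
  case (Suc n)
  from integrable_comp[OF Suc.IH[OF Suc.prems]] show ?case
    by (simp add: iter_weight_Suc funpow_swap1 mult.assoc)
qed (simp add: iter_weight_def)

lemma wco_funpow_class:
  assumes "integrable M \<phi>"
  shows "(wco M w f ^^ n) (L1_class M \<phi>) = L1_class M (\<lambda>x. \<phi> ((f ^^ n) x) * iter_weight w f n x)"
proof (induction n)
  case (Suc n)
  then show ?case
    using wco_class[OF integrable_orbit[OF assms]]
    by (simp add: iter_weight_Suc funpow_swap1 mult.assoc)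
qed (simp add: iter_weight_def)

lemma L1_norm_funpow:
  "integrable M \<phi> \<Longrightarrow> L1_norm M ((wco M w f ^^ n) (L1_class M \<phi>)) = orbit_norm \<phi> n"
  by (simp add: wco_funpow_class L1_norm_class integrable_orbit orbit_norm_def)

lemma L1_dist_funpow:
  assumes "integrable M \<phi>" "integrable M \<psi>"
  shows "L1_dist M ((wco M w f ^^ n) (L1_class M \<phi>)) ((wco M w f ^^ n) (L1_class M \<psi>))
    = orbit_norm (\<lambda>x. \<phi> x - \<psi> x) n"
  using assms by (simp add: wco_funpow_class L1_dist_class integrable_orbit orbit_norm_def left_diff_distrib)

text \<open>The function on the left represents the \<open>m\<close>-th iterate of \<phi>, so its
  orbit is a tail of the orbit of \<phi>.\<close>

lemma orbit_norm_shift: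
  "orbit_norm (\<lambda>x. \<phi> ((f ^^ m) x) * iter_weight w f m x) n = orbit_norm \<phi> (n + m)"
  unfolding orbit_norm_def iter_weight_add
  by (simp add: mult.assoc funpow_add add.commute[of n])

lemma ennreal_orbit_norm:
  assumes "integrable M \<phi>"
  shows "ennreal (orbit_norm \<phi> n) = orbit_integral n (\<lambda>x. ennreal (norm (\<phi> x)))"
  unfolding orbit_norm_def orbit_integral_def
  using integrable_norm[OF integrable_orbit[OF assms, of n]]
  by (subst nn_integral_eq_integral[symmetric]) (simp_all add: norm_mult ennreal_mult)

lemma ennreal_cesaro_mean:
  assumes "integrable M \<phi>"
  shows "ennreal (cesaro_mean (orbit_norm \<phi>) N) = mean_integral N (\<lambda>x. ennreal (norm (\<phi> x)))"
proof (cases "N = 0")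
  case False
  then show ?thesis
    unfolding cesaro_mean_def mean_integral_def
    by (simp add: ennreal_orbit_norm[OF assms, symmetric] sum_nonneg ennreal_of_nat_eq_real_of_nat
        flip: divide_ennreal)
qed (simp add: cesaro_mean_def mean_integral_def)

section \<open>Semi-irregular vectors and mean Li-Yorke chaos\<close>

text \<open>This is an absolutely mean semi-irregular vector: since the means are nonnegative, their
  lower limit is \<open>0\<close> and their upper limit is positive.\<close>

definition semi_irregular :: "('a \<Rightarrow> 'k) \<Rightarrow> bool" where
  "semi_irregular \<phi> \<longleftrightarrow> (\<forall>e>0. \<forall>m. \<exists>N\<ge>m. cesaro_mean (orbit_norm \<phi>) N < e)
     \<and> \<not> cesaro_mean (orbit_norm \<phi>) \<longlonglongrightarrow> 0"

lemma orbit_norm_scale: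
  "orbit_norm (\<lambda>x. c * \<phi> x) n = norm c * orbit_norm \<phi> n"
  by (simp add: orbit_norm_def norm_mult mult.assoc)

lemma cesaro_mean_orbit_norm_scale:
  "cesaro_mean (orbit_norm (\<lambda>x. c * \<phi> x)) N = norm c * cesaro_mean (orbit_norm \<phi>) N"
  by (simp add: cesaro_mean_def orbit_norm_scale sum_distrib_left)

lemma semi_irregular_scale:
  assumes "semi_irregular \<phi>" "c \<noteq> 0"
  shows "semi_irregular (\<lambda>x. c * \<phi> x)"
  unfolding semi_irregular_def cesaro_mean_orbit_norm_scale
proof (intro conjI allI impI notI)
  fix e :: real and m assume "0 < e"
  then have "0 < e / norm c" using assms(2) by simp
  with assms(1) obtain N where "N \<ge> m" "cesaro_mean (orbit_norm \<phi>) N < e / norm c"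
    unfolding semi_irregular_def by blast
  then show "\<exists>N\<ge>m. norm c * cesaro_mean (orbit_norm \<phi>) N < e"
    using assms(2) by (auto simp: field_simps)
next
  assume "(\<lambda>N. norm c * cesaro_mean (orbit_norm \<phi>) N) \<longlonglongrightarrow> 0"
  from tendsto_mult_left[OF this, of "1 / norm c"] assms show False
    by (simp add: semi_irregular_def)
qed

lemma semi_irregular_class_ne_0:
  assumes "integrable M \<phi>" "semi_irregular \<phi>"
  shows "\<not> (AE x in M. \<phi> x = 0)"
proof
  assume "AE x in M. \<phi> x = 0"
  then have "mean_integral N (\<lambda>x. ennreal (norm (\<phi> x))) = mean_integral N (\<lambda>x. 0)" for N
    using borel_measurable_integrable[OF assms(1)]
    by (intro mean_integral_cong_AE) (auto elim: eventually_mono)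
  moreover have "mean_integral N (\<lambda>x. 0) = 0" for N
    by (simp add: mean_integral_def orbit_integral_def)
  ultimately have "cesaro_mean (orbit_norm \<phi>) N \<le> 0" for N
    using ennreal_cesaro_mean[OF assms(1), of N] by (simp add: ennreal_eq_0_iff)
  then have "cesaro_mean (orbit_norm \<phi>) = (\<lambda>_. 0)"
    by (intro ext antisym cesaro_mean_nonneg) auto
  with assms(2) show False by (simp add: semi_irregular_def)
qed

lemma semi_irregular_iff:
  "semi_irregular \<phi> \<longleftrightarrow> liminf (\<lambda>N. ereal (cesaro_mean (orbit_norm \<phi>) N)) = 0
     \<and> limsup (\<lambda>N. ereal (cesaro_mean (orbit_norm \<phi>) N)) > 0"
  by (simp add: semi_irregular_def liminf_ereal_eq_0_iff limsup_ereal_pos_iff cesaro_mean_nonneg)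

text \<open>By linearity the condition on a pair depends only on the difference of its members.
  Hence two distinct points of a scrambled set yield a semi-irregular vector, and conversely the
  real multiples of such a vector form an uncountable scrambled set.\<close>

lemma mean_Li_Yorke_chaotic_iff:
  "mean_Li_Yorke_chaotic (L1 M) (L1_dist M) (wco M w f) \<longleftrightarrow>
    (\<exists>\<phi>. integrable M \<phi> \<and> semi_irregular \<phi>)"
proof
  assume "mean_Li_Yorke_chaotic (L1 M) (L1_dist M) (wco M w f)"
  then obtain S where S: "S \<subseteq> L1 M" "uncountable S" and pair:
    "\<forall>x\<in>S. \<forall>y\<in>S. x \<noteq> y \<longrightarrow>
      liminf (\<lambda>N. ereal ((\<Sum>n=1..N. L1_dist M ((wco M w f ^^ n) x) ((wco M w f ^^ n) y)) / real N)) = 0 \<and>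
      limsup (\<lambda>N. ereal ((\<Sum>n=1..N. L1_dist M ((wco M w f ^^ n) x) ((wco M w f ^^ n) y)) / real N)) > 0"
    unfolding mean_Li_Yorke_chaotic_def by (elim exE conjE) (rule that)
  obtain x where x: "x \<in> S" using S(2) by fastforce
  have "S \<noteq> {x}" using S(2) by auto
  with x obtain y where y: "y \<in> S" "x \<noteq> y" by blast
  define \<phi> where "\<phi> = L1_rep x"
  define \<psi> where "\<psi> = L1_rep y"
  have int: "integrable M \<phi>" "integrable M \<psi>" and xy: "x = L1_class M \<phi>" "y = L1_class M \<psi>"
    using S(1) x y L1_rep[of x M] L1_rep[of y M] by (auto simp: \<phi>_def \<psi>_def)
  have "semi_irregular (\<lambda>t. \<phi> t - \<psi> t)"
    using pair[rule_format, OF x y] unfolding semi_irregular_iff cesaro_mean_def xy L1_dist_funpow[OF int] .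
  with int show "\<exists>\<phi>. integrable M \<phi> \<and> semi_irregular \<phi>" by blast
next
  assume "\<exists>\<phi>. integrable M \<phi> \<and> semi_irregular \<phi>"
  then obtain \<phi> where \<phi>: "integrable M \<phi>" "semi_irregular \<phi>" by blast
  \<comment> \<open>Real multiples suffice for both scalar fields, because a real line is already
    uncountable.\<close>
  define u where "u t = L1_class M (\<lambda>x. of_real t * \<phi> x)" for t :: real
  have int: "integrable M (\<lambda>x. of_real t * \<phi> x)" for t :: real
    using \<phi>(1) by (intro integrable_mult_right)
  have inj: "inj u"
  proof (rule injI, rule ccontr)
    fix s t assume "u s = u t" "s \<noteq> t"
    then have "AE x in M. of_real s * \<phi> x = of_real t * \<phi> x"
      by (simp add: u_def L1_class_eq_iff[OF int int])
    with \<open>s \<noteq> t\<close> have "AE x in M. \<phi> x = 0" by (auto elim: eventually_mono)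
    with semi_irregular_class_ne_0[OF \<phi>] show False by blast
  qed
  have "liminf (\<lambda>N. ereal ((\<Sum>n=1..N. L1_dist M ((wco M w f ^^ n) x) ((wco M w f ^^ n) y)) / real N)) = 0 \<and>
      limsup (\<lambda>N. ereal ((\<Sum>n=1..N. L1_dist M ((wco M w f ^^ n) x) ((wco M w f ^^ n) y)) / real N)) > 0"
    if xy: "x \<in> range u" "y \<in> range u" "x \<noteq> y" for x y
  proof -
    obtain s t where st: "x = u s" "y = u t" using xy by blast
    have "semi_irregular (\<lambda>x. of_real (s - t) * \<phi> x)"
      using xy st by (intro semi_irregular_scale \<phi>) auto
    then show ?thesis
      unfolding semi_irregular_iff
      by (simp add: cesaro_mean_def st u_def L1_dist_funpow[OF int int] left_diff_distrib)
  qed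
  moreover have "range u \<subseteq> L1 M" using int by (auto simp: u_def)
  moreover have "uncountable (range u)"
    using inj uncountable_UNIV_real countable_image_inj_eq by blast
  ultimately show "mean_Li_Yorke_chaotic (L1 M) (L1_dist M) (wco M w f)"
    unfolding mean_Li_Yorke_chaotic_def by blast
qed

section \<open>The uniform bound excludes semi-irregular vectors\<close>

definition bounded_on_proximal :: bool where
  "bounded_on_proximal \<longleftrightarrow>
     (\<exists>C>0. \<forall>B\<in>proximal_sets. \<forall>N. mean_integral N (indicator B) \<le> ennreal C * emeasure M B)"

text \<open>Chebyshev's inequality: the indicator of \<open>B\<close> is at most
  \<open>norm (\<psi> x) / c\<close>, so the measure and all means of \<open>B\<close> are at most
  \<open>1 / c\<close> times those of \<psi>.\<close>

lemma superlevel_set_proximal: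
  assumes \<psi>: "integrable M \<psi>"
    and small: "\<forall>e>0. \<forall>m. \<exists>N\<ge>m. cesaro_mean (orbit_norm \<psi>) N < e"
    and c: "0 < c" and B [measurable]: "B \<in> sets M" and le: "\<And>x. x \<in> B \<Longrightarrow> c \<le> norm (\<psi> x)"
  shows "B \<in> proximal_sets"
proof -
  note [measurable] = borel_measurable_integrable[OF \<psi>]
  have ind: "indicator B x \<le> ennreal (1 / c) * ennreal (norm (\<psi> x))" for x
    using le[of x] c by (auto simp: indicator_def simp flip: ennreal_mult)
  have "emeasure M B = (\<integral>\<^sup>+x. indicator B x \<partial>M)" by simp
  also have "\<dots> \<le> (\<integral>\<^sup>+x. ennreal (1 / c) * ennreal (norm (\<psi> x)) \<partial>M)"
    by (intro nn_integral_mono ind)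
  also have "\<dots> < \<infinity>"
    using \<psi> by (simp add: nn_integral_cmult integrable_iff_bounded ennreal_mult_less_top)
  finally have fin: "emeasure M B < \<infinity>" .
  have "liminf (\<lambda>N. mean_integral N (indicator B)) = 0"
    unfolding liminf_ennreal_eq_0_iff
  proof (intro allI impI)
    fix e :: real and m assume "0 < e"
    then obtain N where N: "N \<ge> m" "cesaro_mean (orbit_norm \<psi>) N < c * e"
      using small c by (meson mult_pos_pos)
    have "mean_integral N (indicator B) \<le> ennreal (1 / c) * mean_integral N (\<lambda>x. ennreal (norm (\<psi> x)))"
      by (subst mean_integral_cmult[symmetric]) (auto intro!: mean_integral_mono ind)
    also have "\<dots> = ennreal (1 / c * cesaro_mean (orbit_norm \<psi>) N)"
      using c by (subst ennreal_mult) (simp_all add: ennreal_cesaro_mean[OF \<psi>] cesaro_mean_nonneg)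
    also have "\<dots> < ennreal e"
      using N(2) c \<open>0 < e\<close> by (intro ennreal_lessI) (simp_all add: field_simps)
    finally show "\<exists>N\<ge>m. mean_integral N (indicator B) < ennreal e" using N(1) by blast
  qed
  with fin show ?thesis by (simp add: proximal_sets_def liminf_mean_zero_iff)
qed

lemma cesaro_mean_dominated:
  assumes C: "0 < C" "\<And>B N. B \<in> proximal_sets \<Longrightarrow> mean_integral N (indicator B) \<le> ennreal C * emeasure M B"
    and \<psi>: "integrable M \<psi>" and U: "\<And>i::nat. U i \<in> proximal_sets"
    and supp: "\<And>x. x \<in> space M \<Longrightarrow> x \<notin> (\<Union>i. U i) \<Longrightarrow> \<psi> x = 0"
  shows "cesaro_mean (orbit_norm \<psi>) N \<le> C * (\<integral>x. norm (\<psi> x) \<partial>M)"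
proof -
  note [measurable] = borel_measurable_integrable[OF \<psi>]
  have "ennreal (cesaro_mean (orbit_norm \<psi>) N) = mean_integral N (\<lambda>x. ennreal (norm (\<psi> x)))"
    by (rule ennreal_cesaro_mean[OF \<psi>])
  also have "\<dots> \<le> ennreal C * (\<integral>\<^sup>+x. ennreal (norm (\<psi> x)) \<partial>M)"
    by (rule mean_integral_dominated[OF C(2) U]) (use supp in auto)
  also have "\<dots> = ennreal (C * (\<integral>x. norm (\<psi> x) \<partial>M))"
    using C(1) \<psi> by (simp add: nn_integral_eq_integral ennreal_mult)
  finally show ?thesis using C(1) by (simp add: ennreal_le_iff)
qed

text \<open>Every iterate of \<phi> has frequently small means, so it is supported in a countable
  union of proximal superlevel sets. A uniform bound would then control its means by its norm, and
  \<open>cesaro_mean_tendsto_0\<close> would make the means of \<phi> tend to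
  \<open>0\<close>.\<close>

lemma semi_irregular_imp_unbounded:
  assumes \<phi>: "integrable M \<phi>" "semi_irregular \<phi>"
  shows "\<not> bounded_on_proximal"
proof
  assume bounded_on_proximal
  then obtain C where C: "0 < C"
    "\<And>B N. B \<in> proximal_sets \<Longrightarrow> mean_integral N (indicator B) \<le> ennreal C * emeasure M B"
    unfolding bounded_on_proximal_def by blast
  have small: "\<forall>e>0. \<forall>m. \<exists>N\<ge>m. cesaro_mean (orbit_norm \<phi>) N < e"
    using \<phi>(2) by (simp add: semi_irregular_def)
  have "cesaro_mean (\<lambda>n. orbit_norm \<phi> (n + m)) N \<le> C * orbit_norm \<phi> m" for m N
  proof -
    define \<psi> where "\<psi> = (\<lambda>x. \<phi> ((f ^^ m) x) * iter_weight w f m x)"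
    have int: "integrable M \<psi>" unfolding \<psi>_def by (rule integrable_orbit[OF \<phi>(1)])
    have eq: "orbit_norm \<psi> = (\<lambda>n. orbit_norm \<phi> (n + m))"
      unfolding \<psi>_def by (rule ext) (rule orbit_norm_shift)
    have "\<forall>e>0. \<forall>k. \<exists>N\<ge>k. cesaro_mean (orbit_norm \<psi>) N < e"
      unfolding eq using cesaro_mean_shift_frequently_small[OF _ small] by simp
    note prox = superlevel_set_proximal[OF int this]
    note [measurable] = borel_measurable_integrable[OF int]
    \<comment> \<open>These countably many superlevel sets exhaust the set where \<psi> does not
      vanish.\<close>
    define U where "U i = {x \<in> space M. 1 / real (Suc i) < norm (\<psi> x)}" for i
    have "U i \<in> proximal_sets" for i
      by (rule prox[of "1 / real (Suc i)"]) (auto simp: U_def)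
    moreover have "\<psi> x = 0" if "x \<in> space M" "x \<notin> (\<Union>i. U i)" for x
    proof (rule ccontr)
      assume "\<psi> x \<noteq> 0"
      then obtain i where "inverse (real (Suc i)) < norm (\<psi> x)"
        using reals_Archimedean[of "norm (\<psi> x)"] by auto
      with that show False by (auto simp: U_def inverse_eq_divide)
    qed
    ultimately have "cesaro_mean (orbit_norm \<psi>) N \<le> C * (\<integral>x. norm (\<psi> x) \<partial>M)"
      by (intro cesaro_mean_dominated[OF C int, of U])
    moreover have "(\<integral>x. norm (\<psi> x) \<partial>M) = orbit_norm \<phi> m"
      by (simp add: orbit_norm_def \<psi>_def)
    ultimately show ?thesis by (simp add: eq)
  qed
  then have "cesaro_mean (orbit_norm \<phi>) \<longlonglongrightarrow> 0"
    by (intro cesaro_mean_tendsto_0[OF _ small _ C(1)]) auto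
  with \<phi>(2) show False by (simp add: semi_irregular_def)
qed

section \<open>Construction of a semi-irregular vector from unboundedness\<close>

lemma integrable_indicator_proximal:
  assumes "B \<in> proximal_sets"
  shows "integrable M (indicator B :: 'a \<Rightarrow> 'k)"
proof -
  have "(\<lambda>x. indicator B x *\<^sub>R (1::'k)) = indicator B" by (auto simp: indicator_def)
  with integrable_indicator[of B M "1::'k"] assms show ?thesis by (simp add: proximal_sets_def)
qed

lemma cesaro_mean_indicator:
  assumes "B \<in> proximal_sets"
  shows "ennreal (cesaro_mean (orbit_norm (indicator B)) N) = mean_integral N (indicator B)"
  unfolding ennreal_cesaro_mean[OF integrable_indicator_proximal[OF assms]]
  by (intro mean_integral_cong) (auto simp: indicator_def)

lemma small_indicator:
  assumes "B \<in> proximal_sets"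
  shows "\<forall>e>0. \<forall>m. \<exists>N\<ge>m. cesaro_mean (orbit_norm (indicator B)) N < e"
proof (intro allI impI)
  fix e :: real and m assume e: "0 < e"
  obtain N where "N \<ge> m" "mean_integral N (indicator B) < ennreal e"
    using assms e by (auto simp: proximal_sets_def liminf_mean_zero_iff liminf_ennreal_eq_0_iff)
  then show "\<exists>N\<ge>m. cesaro_mean (orbit_norm (indicator B)) N < e"
    using e unfolding cesaro_mean_indicator[OF assms, symmetric]
    by (auto simp: ennreal_less_iff cesaro_mean_nonneg)
qed

text \<open>If the means of some proximal indicator do not tend to \<open>0\<close>, that indicator
  is the vector. Otherwise the normalised indicators satisfy the hypotheses of
  \<open>gliding_hump\<close>, and the vector is their weighted sum.\<close>

lemma unbounded_imp_semi_irregular: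
  assumes "\<not> bounded_on_proximal"
  shows "\<exists>\<phi>. integrable M \<phi> \<and> semi_irregular \<phi>"
proof (cases "\<exists>B\<in>proximal_sets. \<not> cesaro_mean (orbit_norm (indicator B)) \<longlonglongrightarrow> 0")
  case True
  then show ?thesis
    using integrable_indicator_proximal small_indicator unfolding semi_irregular_def by blast
next
  case False
  \<comment> \<open>Null sets are discarded so that \<open>p N B\<close>, the mean of the indicator
    divided by the measure, is a genuine normalisation.\<close>
  define H where "H = {B \<in> proximal_sets. 0 < emeasure M B}"
  define p where "p N B = cesaro_mean (orbit_norm (indicator B)) N / measure M B" for N B
  obtain K :: "nat \<Rightarrow> real" where K: "\<And>N. 0 \<le> K N"
    "\<And>N g. g \<in> borel_measurable M \<Longrightarrow> mean_integral N g \<le> ennreal (K N) * (\<integral>\<^sup>+x. g x \<partial>M)"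
    using mean_integral_bound by metis
  have sets [measurable]: "B \<in> sets M" and em: "emeasure M B = ennreal (measure M B)"
    and pos: "0 < measure M B" if "B \<in> H" for B
  proof -
    show "B \<in> sets M" using that by (simp add: H_def proximal_sets_def)
    show em: "emeasure M B = ennreal (measure M B)"
      using that by (intro emeasure_eq_ennreal_measure) (simp add: H_def proximal_sets_def less_top)
    have "0 < emeasure M B" using that by (simp add: H_def)
    then show "0 < measure M B" unfolding em by simp
  qed
  have mean_p: "mean_integral N (indicator B) = ennreal (measure M B * p N B)" if "B \<in> H" for N B
    using pos[OF that] that by (simp add: p_def cesaro_mean_indicator H_def)
  have p_nonneg: "0 \<le> p N B" for N B by (simp add: p_def cesaro_mean_nonneg)
  have p_bound: "p N B \<le> K N" if "B \<in> H" for N B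
  proof -
    have "ennreal (measure M B * p N B) \<le> ennreal (K N) * emeasure M B"
      using K(2)[of "indicator B" N] sets[OF that] by (simp flip: mean_p[OF that])
    also have "\<dots> = ennreal (measure M B * K N)"
      using K(1) by (simp add: em[OF that] ennreal_mult mult.commute)
    finally show ?thesis
      using pos[OF that] K(1)[of N] by (simp add: ennreal_le_iff)
  qed
  have p_null: "(\<lambda>N. p N B) \<longlonglongrightarrow> 0" if "B \<in> H" for B
    using False that unfolding p_def H_def by (intro tendsto_divide_zero) auto
  have p_unbounded: "\<exists>B\<in>H. \<exists>N\<ge>1. C < p N B" for C
  proof -
    \<comment> \<open>\<open>bounded_on_proximal\<close> quantifies over positive constants only, so
      its negation is applied to a positive constant above \<open>C\<close>.\<close>
    define C' where "C' = max C 1"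
    obtain B N where B: "B \<in> proximal_sets" "ennreal C' * emeasure M B < mean_integral N (indicator B)"
      using assms unfolding bounded_on_proximal_def
      by (metis C'_def max.strict_coboundedI2 not_less zero_less_one)
    have "0 < N" using B(2) by (cases N) (simp_all add: mean_integral_def)
    \<comment> \<open>A null set has all means equal to \<open>0\<close> by the bound with
      \<open>K N\<close>, and so cannot violate any bound.\<close>
    have "emeasure M B \<noteq> 0"
    proof
      assume "emeasure M B = 0"
      moreover have "B \<in> sets M" using B(1) by (simp add: proximal_sets_def)
      ultimately show False using K(2)[of "indicator B" N] B(2) by simp
    qed
    then have H: "B \<in> H" using B(1) by (simp add: H_def zero_less_iff_neq_zero)
    have "ennreal (measure M B * C') < ennreal (measure M B * p N B)"
      using B(2) unfolding mean_p[OF H] em[OF H]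
      by (simp add: C'_def ennreal_mult mult.commute)
    then have "C' < p N B" using pos[OF H] by (simp add: ennreal_less_iff C'_def p_nonneg)
    then show ?thesis using H \<open>0 < N\<close> by (auto simp: C'_def intro!: bexI[of _ B] exI[of _ N])
  qed
  obtain b :: "nat \<Rightarrow> real" and h where b: "\<And>k. 0 < b k" and h: "\<And>k. h k \<in> H" and sum_b: "summable b"
    and sum_bp: "\<And>N. summable (\<lambda>k. b k * p N (h k))"
    and small: "\<forall>e>0. \<forall>m. \<exists>N\<ge>m. (\<Sum>k. b k * p N (h k)) < e"
    and large: "\<And>k. \<exists>N\<ge>1. real k < b k * p N (h k)"
    by (rule gliding_hump[of H p K, OF p_nonneg p_bound p_null p_unbounded]; (assumption | (rule that; blast)))
  have [measurable]: "h k \<in> sets M" for k using sets[OF h] .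
  \<comment> \<open>The series is summed in the extended reals, where it needs no pointwise
    convergence. Its integral is the sum of the weights \<open>b\<close>, hence finite.\<close>
  define g where "g x = (\<Sum>k. ennreal (b k / measure M (h k)) * indicator (h k) x)" for x
  have g [measurable]: "g \<in> borel_measurable M" unfolding g_def by measurable
  have "(\<integral>\<^sup>+x. g x \<partial>M) = (\<Sum>k. ennreal (b k / measure M (h k)) * emeasure M (h k))"
    unfolding g_def by (subst nn_integral_suminf) (simp_all add: nn_integral_cmult)
  also have "\<dots> = (\<Sum>k. ennreal (b k))"
  proof (rule suminf_cong)
    fix k
    show "ennreal (b k / measure M (h k)) * emeasure M (h k) = ennreal (b k)"
      using b[of k] pos[OF h, of k] unfolding em[OF h] by (subst ennreal_mult[symmetric]) auto
  qed
  also have "\<dots> < \<infinity>"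
    using ennreal_suminf_neq_top[OF sum_b less_imp_le[OF b]] by (simp add: less_top)
  finally have g_fin: "(\<integral>\<^sup>+x. g x \<partial>M) < \<infinity>" .
  have mean_g: "mean_integral N g = ennreal (\<Sum>k. b k * p N (h k))" for N
  proof -
    have "mean_integral N g = (\<Sum>k. ennreal (b k / measure M (h k)) * mean_integral N (indicator (h k)))"
      unfolding g_def by (subst mean_integral_suminf) (simp_all add: mean_integral_cmult)
    also have "\<dots> = (\<Sum>k. ennreal (b k * p N (h k)))"
    proof (rule suminf_cong)
      fix k
      show "ennreal (b k / measure M (h k)) * mean_integral N (indicator (h k)) = ennreal (b k * p N (h k))"
        using b[of k] pos[OF h, of k] p_nonneg[of N "h k"] unfolding mean_p[OF h]
        by (subst ennreal_mult[symmetric]) auto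
    qed
    also have "\<dots> = ennreal (\<Sum>k. b k * p N (h k))"
      using b p_nonneg by (intro suminf_ennreal2 sum_bp) (simp add: less_imp_le)
    finally show ?thesis .
  qed
  \<comment> \<open>\<open>enn2real\<close> replaces the value infinity by \<open>0\<close>, which
    happens only on a null set.\<close>
  define \<phi> :: "'a \<Rightarrow> 'k" where "\<phi> x = of_real (enn2real (g x))" for x
  have \<phi>_meas [measurable]: "\<phi> \<in> borel_measurable M" unfolding \<phi>_def by measurable
  have "AE x in M. g x \<noteq> \<infinity>" using g_fin by (intro nn_integral_PInf_AE) auto
  then have \<phi>_g: "AE x in M. ennreal (norm (\<phi> x)) = g x"
    by eventually_elim (simp add: \<phi>_def top.not_eq_extremum)
  have int: "integrable M \<phi>"
    using g_fin nn_integral_cong_AE[OF \<phi>_g] by (intro integrableI_bounded) auto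
  have mean_\<phi>: "cesaro_mean (orbit_norm \<phi>) N = (\<Sum>k. b k * p N (h k))" for N
  proof -
    have "ennreal (cesaro_mean (orbit_norm \<phi>) N) = mean_integral N g"
      unfolding ennreal_cesaro_mean[OF int] by (rule mean_integral_cong_AE[OF _ g \<phi>_g]) simp
    moreover have "0 \<le> (\<Sum>k. b k * p N (h k))"
      using b p_nonneg by (intro suminf_nonneg sum_bp) (simp add: less_imp_le)
    ultimately show ?thesis by (simp add: mean_g cesaro_mean_nonneg)
  qed
  \<comment> \<open>Convergent means would be bounded, whereas all humps are nonnegative and the
    \<open>k\<close>-th one alone exceeds \<open>k\<close> at some time.\<close>
  have "\<not> cesaro_mean (orbit_norm \<phi>) \<longlonglongrightarrow> 0"
  proof
    assume "cesaro_mean (orbit_norm \<phi>) \<longlonglongrightarrow> 0"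
    then have "Bseq (cesaro_mean (orbit_norm \<phi>))" by (rule convergent_imp_Bseq[OF convergentI])
    then obtain L where L: "\<And>N. cesaro_mean (orbit_norm \<phi>) N \<le> L"
      by (metis BseqE abs_le_D1 real_norm_def)
    obtain k where k: "L < real k" using reals_Archimedean2 by blast
    obtain N where "real k < b k * p N (h k)" using large by blast
    also have "\<dots> \<le> (\<Sum>k. b k * p N (h k))"
      using sum_le_suminf[OF sum_bp, of "{k}"] b p_nonneg by (simp add: less_imp_le)
    also have "\<dots> \<le> L" using L[of N] by (simp add: mean_\<phi>)
    finally show False using k by simp
  qed
  then have "semi_irregular \<phi>" unfolding semi_irregular_def using small by (simp add: mean_\<phi>)
  with int show ?thesis by blast
qed

section \<open>Absolute Cesaro boundedness on the closed span\<close>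

definition proximal_subspace :: "('a \<Rightarrow> 'k) set set" where
  "proximal_subspace = L1_closed_span M (indicator ` proximal_sets)"

lemma indicator_in_proximal_subspace:
  assumes "B \<in> proximal_sets"
  shows "L1_class M (indicator B) \<in> proximal_subspace"
proof -
  interpret Metric_space "L1 M" "L1_dist M" by (rule Metric_space_L1)
  have "L1_class M (indicator B) \<in> L1_span M (indicator ` proximal_sets :: ('a \<Rightarrow> 'k) set)"
    unfolding L1_span_def
    by (rule CollectI, intro exI[of _ "{indicator B}"] exI[of _ "\<lambda>_. 1"]) (use assms in auto)
  moreover have "L1_class M (indicator B :: 'a \<Rightarrow> 'k) \<in> L1 M"
    using integrable_indicator_proximal[OF assms] by simp
  ultimately show ?thesis
    unfolding proximal_subspace_def L1_closed_span_def metric_closure_of by auto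
qed

text \<open>It suffices to test the inequality on classes of indicators, whose norm is the measure
  of the set.\<close>

lemma absolutely_Cesaro_bounded_imp_bounded:
  assumes "absolutely_Cesaro_bounded_in (L1_norm M) (wco M w f) proximal_subspace"
  shows bounded_on_proximal
proof -
  obtain C where C: "0 < C" "\<And>y. y \<in> proximal_subspace \<Longrightarrow>
    (SUP N\<in>{1..}. ereal ((\<Sum>n=1..N. L1_norm M ((wco M w f ^^ n) y)) / real N)) \<le> ereal (C * L1_norm M y)"
    using assms unfolding absolutely_Cesaro_bounded_in_def by blast
  \<comment> \<open>The supremum runs over \<open>N \<ge> 1\<close>; for \<open>N = 0\<close> the
    mean is \<open>0\<close>.\<close>
  have "mean_integral N (indicator B) \<le> ennreal C * emeasure M B" if B: "B \<in> proximal_sets" for N B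
  proof (cases "N = 0")
    case False
    note int = integrable_indicator_proximal[OF B]
    have em: "emeasure M B = ennreal (measure M B)"
      using B by (intro emeasure_eq_ennreal_measure) (simp add: proximal_sets_def less_top)
    have "ereal (cesaro_mean (orbit_norm (indicator B)) N)
      \<le> (SUP N\<in>{1..}. ereal ((\<Sum>n=1..N. L1_norm M ((wco M w f ^^ n) (L1_class M (indicator B)))) / real N))"
      using False by (intro SUP_upper2[of N]) (simp_all add: L1_norm_funpow[OF int] cesaro_mean_def)
    also have "\<dots> \<le> ereal (C * L1_norm M (L1_class M (indicator B :: 'a \<Rightarrow> 'k)))"
      by (rule C(2)[OF indicator_in_proximal_subspace[OF B]])
    also have "L1_norm M (L1_class M (indicator B :: 'a \<Rightarrow> 'k)) = measure M B"
    proof -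
      have "norm (indicator B x :: 'k) = indicator B x" for x by (simp add: indicator_def)
      then show ?thesis
        using B by (simp add: L1_norm_class[OF int] proximal_sets_def)
    qed
    finally show ?thesis
      using C(1) unfolding cesaro_mean_indicator[OF B, symmetric] em
      by (simp flip: ennreal_mult add: ennreal_leI)
  qed (simp add: mean_integral_def)
  with C(1) show ?thesis unfolding bounded_on_proximal_def by blast
qed

lemma orbit_norm_triangle:
  assumes "integrable M \<phi>" "integrable M \<psi>"
  shows "orbit_norm \<phi> n \<le> orbit_norm \<psi> n + orbit_norm (\<lambda>x. \<phi> x - \<psi> x) n"
proof -
  note int = assms[THEN integrable_orbit, of n]
  have diff: "integrable M (\<lambda>x. (\<phi> ((f ^^ n) x) - \<psi> ((f ^^ n) x)) * iter_weight w f n x)"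
    using Bochner_Integration.integrable_diff[OF int] by (simp add: left_diff_distrib)
  have "orbit_norm \<phi> n \<le> (\<integral>x. norm (\<psi> ((f ^^ n) x) * iter_weight w f n x)
      + norm ((\<phi> ((f ^^ n) x) - \<psi> ((f ^^ n) x)) * iter_weight w f n x) \<partial>M)"
    unfolding orbit_norm_def
  proof (intro integral_mono integrable_norm Bochner_Integration.integrable_add int diff)
    fix x
    show "norm (\<phi> ((f ^^ n) x) * iter_weight w f n x) \<le> norm (\<psi> ((f ^^ n) x) * iter_weight w f n x)
      + norm ((\<phi> ((f ^^ n) x) - \<psi> ((f ^^ n) x)) * iter_weight w f n x)"
      using norm_triangle_ineq[of "\<psi> ((f ^^ n) x) * iter_weight w f n x"
        "(\<phi> ((f ^^ n) x) - \<psi> ((f ^^ n) x)) * iter_weight w f n x"]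
      by (simp add: left_diff_distrib)
  qed
  also have "\<dots> = orbit_norm \<psi> n + orbit_norm (\<lambda>x. \<phi> x - \<psi> x) n"
    unfolding orbit_norm_def by (intro Bochner_Integration.integral_add integrable_norm int diff)
  finally show ?thesis .
qed

lemma cesaro_mean_orbit_norm_triangle:
  assumes "integrable M \<phi>" "integrable M \<psi>"
  shows "cesaro_mean (orbit_norm \<phi>) N \<le>
    cesaro_mean (orbit_norm \<psi>) N + cesaro_mean (orbit_norm (\<lambda>x. \<phi> x - \<psi> x)) N"
  unfolding cesaro_mean_def add_divide_distrib[symmetric] sum.distrib[symmetric]
  by (intro divide_right_mono sum_mono orbit_norm_triangle assms) simp

text \<open>A member of the span is supported in finitely many proximal sets and inherits the
  constant \<open>C\<close>. For a fixed \<open>N\<close> the mean is continuous in the L1 norm, so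
  the inequality passes to the closure with the same \<open>C\<close>, although the modulus of
  continuity depends on \<open>N\<close>.\<close>

lemma bounded_imp_absolutely_Cesaro_bounded:
  assumes bounded_on_proximal
  shows "absolutely_Cesaro_bounded_in (L1_norm M) (wco M w f) proximal_subspace"
proof -
  obtain C where C: "0 < C"
    "\<And>B N. B \<in> proximal_sets \<Longrightarrow> mean_integral N (indicator B) \<le> ennreal C * emeasure M B"
    using assms unfolding bounded_on_proximal_def by blast
  obtain K :: "nat \<Rightarrow> real" where K: "\<And>N. 0 \<le> K N"
    "\<And>N g. g \<in> borel_measurable M \<Longrightarrow> mean_integral N g \<le> ennreal (K N) * (\<integral>\<^sup>+x. g x \<partial>M)"
    using mean_integral_bound by metis
  interpret L: Metric_space "L1 M" "L1_dist M :: ('a \<Rightarrow> 'k) set \<Rightarrow> _" by (rule Metric_space_L1)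
  have main: "cesaro_mean (orbit_norm \<phi>) N \<le> C * (\<integral>x. norm (\<phi> x) \<partial>M)"
    if \<phi>: "integrable M \<phi>" and cl: "L1_class M \<phi> \<in> proximal_subspace" for \<phi> N
  proof (rule field_le_epsilon)
    fix e :: real assume e: "0 < e"
    \<comment> \<open>The approximation error enters twice: \<open>C * d\<close> from comparing the
      norms of \<phi> and \<psi>, and \<open>K N * d\<close> from the mean of their
      difference.\<close>
    define d where "d = e / (C + K N)"
    have d: "0 < d" using e C(1) K(1)[of N] by (simp add: d_def add_pos_nonneg)
    obtain v where v: "v \<in> L1_span M (indicator ` proximal_sets)" "L1_dist M (L1_class M \<phi>) v < d"
      using cl d unfolding proximal_subspace_def L1_closed_span_def L.metric_closure_of by auto
    obtain F c where F: "finite F" "F \<subseteq> indicator ` proximal_sets"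
      and v_eq: "v = L1_class M (\<lambda>x. \<Sum>\<theta>\<in>F. c \<theta> * \<theta> x)"
      using v(1) unfolding L1_span_def by blast
    define \<psi> where "\<psi> = (\<lambda>x. \<Sum>\<theta>\<in>F. c \<theta> * \<theta> x)"
    have \<psi>: "integrable M \<psi>"
      unfolding \<psi>_def using F(2) integrable_indicator_proximal
      by (intro Bochner_Integration.integrable_sum integrable_mult_right) auto
    have dist: "(\<integral>x. norm (\<phi> x - \<psi> x) \<partial>M) < d"
      using v(2) by (simp add: v_eq L1_dist_class[OF \<phi> \<psi>, symmetric] flip: \<psi>_def)
    have "{} \<in> proximal_sets"
      by (simp add: proximal_sets_def liminf_mean_zero_iff mean_integral_def orbit_integral_def Liminf_const)
    obtain D where D: "finite D" "D \<subseteq> proximal_sets" "F = indicator ` D"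
      using finite_subset_image[OF F] by blast
    \<comment> \<open>Inserting the empty set keeps the enumerated set nonempty even when the linear
      combination is empty.\<close>
    define U where "U = from_nat_into (insert {} D)"
    have U: "range U = insert {} D"
      unfolding U_def using D(1) by (intro range_from_nat_into) (auto intro: countable_finite)
    have U_prox: "U i \<in> proximal_sets" for i
    proof -
      have "U i \<in> insert {} D" unfolding U[symmetric] by simp
      then show ?thesis using D(2) \<open>{} \<in> proximal_sets\<close> by auto
    qed
    have supp: "\<psi> x = 0" if "x \<notin> (\<Union>i. U i)" for x
      unfolding \<psi>_def by (rule sum.neutral) (use that D(3) in \<open>auto simp: U\<close>)
    have mean_\<psi>: "cesaro_mean (orbit_norm \<psi>) N \<le> C * (\<integral>x. norm (\<psi> x) \<partial>M)"
      by (rule cesaro_mean_dominated[OF C \<psi> U_prox supp])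
    have diff: "integrable M (\<lambda>x. \<phi> x - \<psi> x)" using \<phi> \<psi> by simp
    have mean_diff: "cesaro_mean (orbit_norm (\<lambda>x. \<phi> x - \<psi> x)) N \<le> K N * (\<integral>x. norm (\<phi> x - \<psi> x) \<partial>M)"
    proof -
      have "ennreal (cesaro_mean (orbit_norm (\<lambda>x. \<phi> x - \<psi> x)) N)
        \<le> ennreal (K N) * (\<integral>\<^sup>+x. ennreal (norm (\<phi> x - \<psi> x)) \<partial>M)"
        unfolding ennreal_cesaro_mean[OF diff]
        using borel_measurable_integrable[OF \<phi>] borel_measurable_integrable[OF \<psi>]
        by (intro K(2)) measurable
      also have "\<dots> = ennreal (K N * (\<integral>x. norm (\<phi> x - \<psi> x) \<partial>M))"
        using K(1)[of N] integrable_norm[OF diff] by (simp add: nn_integral_eq_integral ennreal_mult)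
      finally show ?thesis using K(1)[of N] by (simp add: ennreal_le_iff)
    qed
    have "(\<integral>x. norm (\<psi> x) \<partial>M) \<le> (\<integral>x. norm (\<phi> x) \<partial>M) + (\<integral>x. norm (\<phi> x - \<psi> x) \<partial>M)"
      using orbit_norm_triangle[OF \<psi> \<phi>, of 0] by (simp add: orbit_norm_0 norm_minus_commute)
    then have "C * (\<integral>x. norm (\<psi> x) \<partial>M) \<le> C * ((\<integral>x. norm (\<phi> x) \<partial>M) + d)"
      using C(1) dist by (intro mult_left_mono) auto
    moreover have "K N * (\<integral>x. norm (\<phi> x - \<psi> x) \<partial>M) \<le> K N * d"
      using K(1)[of N] dist by (intro mult_left_mono) auto
    ultimately have "cesaro_mean (orbit_norm \<phi>) N \<le> C * ((\<integral>x. norm (\<phi> x) \<partial>M) + d) + K N * d"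
      using cesaro_mean_orbit_norm_triangle[OF \<phi> \<psi>, of N] mean_\<psi> mean_diff by linarith
    also have "\<dots> = C * (\<integral>x. norm (\<phi> x) \<partial>M) + (C + K N) * d" by (simp add: algebra_simps)
    also have "(C + K N) * d = e" using C(1) K(1)[of N] by (simp add: d_def)
    finally show "cesaro_mean (orbit_norm \<phi>) N \<le> C * (\<integral>x. norm (\<phi> x) \<partial>M) + e" .
  qed
  show ?thesis
    unfolding absolutely_Cesaro_bounded_in_def
  proof (intro exI[of _ C] conjI ballI C(1))
    fix y :: "('a \<Rightarrow> 'k) set" assume y: "y \<in> proximal_subspace"
    then have "y \<in> L1 M"
      unfolding proximal_subspace_def L1_closed_span_def L.metric_closure_of by blast
    then obtain \<phi> where \<phi>: "integrable M \<phi>" "y = L1_class M \<phi>" using L1_rep[of y M] by metis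
    show "(SUP N\<in>{1..}. ereal ((\<Sum>n=1..N. L1_norm M ((wco M w f ^^ n) y)) / real N))
      \<le> ereal (C * L1_norm M y)"
      using main[OF \<phi>(1)] y
      by (intro SUP_least) (simp add: \<phi> L1_norm_funpow L1_norm_class cesaro_mean_def)
  qed
qed

section \<open>Countable families with unbounded quotients\<close>

text \<open>Without a bound, each \<open>k\<close> has a set and a time whose quotient exceeds
  \<open>k\<close>, and these sets form the family. Conversely all members of a family are proximal,
  so a bound would cap every quotient. Subsets of \<open>nat\<close> serve as index sets for
  arbitrary countable families.\<close>

lemma unbounded_iff_family:
  "\<not> bounded_on_proximal \<longleftrightarrow>
    (\<exists>(I :: nat set) (B :: nat \<Rightarrow> 'a set).
       I \<noteq> {} \<and>
       (\<forall>i\<in>I. B i \<in> sets M \<and> 0 < emeasure M (B i) \<and> emeasure M (B i) < \<infinity>) \<and>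
       (\<forall>i\<in>I. liminf_mean_zero M w f (B i)) \<and>
       Sup {(\<Sum>n=1..N. iter_measure M w f n (iter_preimage M f n (B i)) / emeasure M (B i)) / of_nat N
             |i N. i \<in> I \<and> 1 \<le> N} = \<infinity>)" (is "_ \<longleftrightarrow> ?family")
proof -
  have quot: "(\<Sum>n=1..N. iter_measure M w f n (iter_preimage M f n B) / emeasure M B) / of_nat N
      = mean_integral N (indicator B) / emeasure M B" for N B
    by (simp add: iter_measure_preimage mean_integral_def divide_ennreal_def sum_distrib_right
        mult.assoc mult.commute[of "inverse (emeasure M B)"])
  \<comment> \<open>Clearing the denominator in the extended reals uses that it is neither
    \<open>0\<close> nor infinite.\<close>
  have less_quot: "c < mean_integral N (indicator B) / emeasure M B \<longleftrightarrow>
      c * emeasure M B < mean_integral N (indicator B)"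
    if "0 < emeasure M B" "emeasure M B < \<infinity>" for c N B
  proof -
    have "mean_integral N (indicator B) / emeasure M B \<le> c \<longleftrightarrow>
        mean_integral N (indicator B) \<le> c * emeasure M B"
    proof
      assume "mean_integral N (indicator B) / emeasure M B \<le> c"
      from mult_right_mono[OF this, of "emeasure M B"] that
      show "mean_integral N (indicator B) \<le> c * emeasure M B"
        by (simp add: ennreal_divide_times ennreal_divide_self)
    next
      assume "mean_integral N (indicator B) \<le> c * emeasure M B"
      then show "mean_integral N (indicator B) / emeasure M B \<le> c"
        by (intro divide_le_posI_ennreal that) (simp add: mult.commute)
    qed
    then show ?thesis by (simp add: not_le[symmetric])
  qed
  show ?thesis
  proof
    assume unb: "\<not> bounded_on_proximal"
    have "\<exists>B N. B \<in> proximal_sets \<and> 0 < emeasure M B \<and> 1 \<le> N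
        \<and> of_nat k * emeasure M B < mean_integral N (indicator B)" for k :: nat
    proof -
      \<comment> \<open>\<open>Suc k\<close> keeps the constant positive at \<open>k = 0\<close>, as
        the negated bound speaks of positive constants only.\<close>
      obtain B N where B: "B \<in> proximal_sets"
        "ennreal (real (Suc k)) * emeasure M B < mean_integral N (indicator B)"
        using unb unfolding bounded_on_proximal_def by (metis not_less of_nat_0_less_iff zero_less_Suc)
      obtain K :: "nat \<Rightarrow> real" where K:
        "\<And>N g. g \<in> borel_measurable M \<Longrightarrow> mean_integral N g \<le> ennreal (K N) * (\<integral>\<^sup>+x. g x \<partial>M)"
        using mean_integral_bound by metis
      \<comment> \<open>This crude bound rules out null sets, since their means would
        vanish.\<close>
      have c: "mean_integral N (indicator B) \<le> ennreal (K N) * emeasure M B"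
      proof -
        have "B \<in> sets M" using B(1) by (simp add: proximal_sets_def)
        then show ?thesis using K[of "indicator B" N] by simp
      qed
      have "0 < emeasure M B"
        using B(2) c by (cases "emeasure M B = 0") (auto simp: zero_less_iff_neq_zero)
      moreover have "1 \<le> N" using B(2) by (cases N) (simp_all add: mean_integral_def)
      moreover have "of_nat k * emeasure M B \<le> ennreal (real (Suc k)) * emeasure M B"
        by (intro mult_right_mono) (simp_all flip: ennreal_of_nat_eq_real_of_nat)
      ultimately show ?thesis using B order_le_less_trans by blast
    qed
    then obtain B N where B: "\<And>k::nat. B k \<in> proximal_sets" "\<And>k. 0 < emeasure M (B k)" "\<And>k. 1 \<le> N k"
      "\<And>k. of_nat k * emeasure M (B k) < mean_integral (N k) (indicator (B k))" by metis
    have fin: "emeasure M (B k) < \<infinity>" for k using B(1) by (simp add: proximal_sets_def)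
    have "Sup {mean_integral N (indicator (B i)) / emeasure M (B i) |i N. i \<in> UNIV \<and> 1 \<le> N} = \<infinity>"
      (is "Sup ?A = _")
    proof (rule ccontr)
      assume "Sup ?A \<noteq> \<infinity>"
      then have "Sup ?A < top" by (simp only: less_top infinity_ennreal_def not_False_eq_True)
      then obtain k where k: "Sup ?A < of_nat k" by (rule ennreal_Ex_less_of_nat[THEN exE])
      have "of_nat k < mean_integral (N k) (indicator (B k)) / emeasure M (B k)"
        using less_quot[OF B(2) fin] B(4) by blast
      also have "\<dots> \<le> Sup ?A" using B(3) by (intro Sup_upper) blast
      finally show False using k by simp
    qed
    moreover have "B k \<in> sets M" "liminf_mean_zero M w f (B k)" for k
      using B(1) by (simp_all add: proximal_sets_def)
    ultimately show ?family
      unfolding quot using B(2) fin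
      by - (rule exI[of _ UNIV], rule exI[of _ B], simp)
  next
    assume ?family
    then obtain I :: "nat set" and B :: "nat \<Rightarrow> 'a set" where
      B: "\<And>i. i \<in> I \<Longrightarrow> B i \<in> sets M \<and> 0 < emeasure M (B i) \<and> emeasure M (B i) < \<infinity>"
        "\<And>i. i \<in> I \<Longrightarrow> liminf_mean_zero M w f (B i)"
      and Sup: "Sup {mean_integral N (indicator (B i)) / emeasure M (B i) |i N. i \<in> I \<and> 1 \<le> N} = \<infinity>"
      unfolding quot by blast
    show "\<not> bounded_on_proximal"
    proof
      assume bounded_on_proximal
      then obtain C where C: "\<And>B N. B \<in> proximal_sets \<Longrightarrow>
          mean_integral N (indicator B) \<le> ennreal C * emeasure M B"
        unfolding bounded_on_proximal_def by blast
      have "ennreal C < Sup {mean_integral N (indicator (B i)) / emeasure M (B i) |i N. i \<in> I \<and> 1 \<le> N}"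
        unfolding Sup by simp
      then obtain i N where i: "i \<in> I" "ennreal C < mean_integral N (indicator (B i)) / emeasure M (B i)"
        by (auto simp: less_Sup_iff)
      with B[OF i(1)] have "B i \<in> proximal_sets" by (simp add: proximal_sets_def)
      from C[OF this, of N] i less_quot B(1)[OF i(1)] show False by (metis not_less)
    qed
  qed
qed

end

theorem corollary69:
  fixes M :: "'a measure"
    and w :: "'a \<Rightarrow> 'k::{real_normed_field, euclidean_space}"
    and f :: "'a \<Rightarrow> 'a"
    and \<XX> :: "('a \<Rightarrow> 'k) set set"
  assumes "weighted_composition M w f"
    and "\<XX> = L1_closed_span M
      {indicator B |B. B \<in> sets M \<and> emeasure M B < \<infinity> \<and> liminf_mean_zero M w f B}"
  shows "(mean_Li_Yorke_chaotic (L1 M) (L1_dist M) (wco M w f) \<longleftrightarrow>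
          (\<exists>(I :: nat set) (B :: nat \<Rightarrow> 'a set).
             I \<noteq> {} \<and>
             (\<forall>i\<in>I. B i \<in> sets M \<and> 0 < emeasure M (B i) \<and> emeasure M (B i) < \<infinity>) \<and>
             (\<forall>i\<in>I. liminf_mean_zero M w f (B i)) \<and>
             Sup {(\<Sum>n=1..N. iter_measure M w f n (iter_preimage M f n (B i)) / emeasure M (B i)) / of_nat N
                   |i N. i \<in> I \<and> 1 \<le> N} = \<infinity>)) \<and>
         (mean_Li_Yorke_chaotic (L1 M) (L1_dist M) (wco M w f) \<longleftrightarrow>
          \<not> absolutely_Cesaro_bounded_in (L1_norm M) (wco M w f) \<XX>)"
proof -
  interpret weighted_composition M w f by fact
  have "{indicator B |B. B \<in> sets M \<and> emeasure M B < \<infinity> \<and> liminf_mean_zero M w f B}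
      = (indicator ` proximal_sets :: ('a \<Rightarrow> 'k) set)"
    unfolding proximal_sets_def by blast
  then have X: "\<XX> = proximal_subspace" by (simp add: assms(2) proximal_subspace_def)
  have "mean_Li_Yorke_chaotic (L1 M) (L1_dist M) (wco M w f) \<longleftrightarrow> \<not> bounded_on_proximal"
    unfolding mean_Li_Yorke_chaotic_iff
    using semi_irregular_imp_unbounded unbounded_imp_semi_irregular by blast
  moreover have "absolutely_Cesaro_bounded_in (L1_norm M) (wco M w f) \<XX> \<longleftrightarrow> bounded_on_proximal"
    unfolding X
    using absolutely_Cesaro_bounded_imp_bounded bounded_imp_absolutely_Cesaro_bounded by blast
  ultimately show ?thesis using unbounded_iff_family by simp
qed

end
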